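(* Let $H$ be a computable Hilbert space and $(H_i)_{i\in\mathbb N}$ a sequence of computable Hilbert spaces. Let $\{\Lambda_i:i\in\mathbb N\}$ be a computable $g$-frame for $H$ with respect to $\{H_i:i\in\mathbb N\}$, and for each $i\in\mathbb N$ let $\{g_{ij}:j\in\mathbb N\}$ be a computable frame for $H_i$ with frame bounds $A_i$ and $B_i$, such that $0<A=\inf_i A_i$ and $B=\sup_i B_i<\infty$. Then $\{\Lambda_i^*g_{ij}:i,j\in\mathbb N\}$ is a computable frame for $H$ provided $\{\|\Lambda_i^*g_{ij}\|:i,j\in\mathbb N\}$ is a computable double sequence of reals.
   Context: Computability is in the sense of representation-based computable analysis (Type-2 Turing machines). A computable Hilbert space $(H,\langle\cdot,\cdot\rangle,e)$ is a separable Hilbert space with a sequence $e:\mathbb N\to H$ whose linear span is dense such that, for a standard enumeration $\alpha_e$ of finite linear combinations of the $e_i$ with coefficients from a standard countable dense subset of the scalar field, the distances $\|\alpha_e(n)-\alpha_e(m)\|$ form a computable double sequence; it is represented by its Cauchy representation $\delta_H$ (a name of $x$ encodes $(n_k)$ with $\|\alpha_e(n_k)-\alpha_e(n_l)\|<2^{-k}$ for $l>k$ and $x=\lim\alpha_e(n_k)$). A (double) sequence is computable if the map from indices to elements is computable. $[\delta\to\delta']$ denotes the standard representation of continuous functions. A frame for a Hilbert space $K$ with bounds $A,B$ is a sequence $(f_k)$ with $0<A\le B$ and $A\|f\|^2\le\sum_k|\langle f,f_k\rangle|^2\le B\|f\|^2$ for all $f\in K$; a computable frame is a frame which is a computable sequence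 in $(K,\delta_K)$. A sequence $\Lambda_i\in L(H,H_i)$ is a $g$-frame for $H$ with respect to $\{H_i\}$ if there are $0<A\le B<\infty$ with $A\|f\|^2\le\sum_i\|\Lambda_if\|^2\le B\|f\|^2$ for all $f\in H$; it is a computable $g$-frame if moreover $(\Lambda_i)$ is a computable sequence, i.e. from $i$ one can compute a $[\delta_H\to\delta_{H_i}]$-name of $\Lambda_i$.
   Formalization: The sequence of computable Hilbert spaces H_i is taken to be computable uniformly in i, and the frames g_ij are assumed to form a computable double sequence in (i,j); with computability only for each i separately the claim is false. *)

theory Defs
  imports
    "HOL-Algebra.Module"
    "HOL-Analysis.Infinite_Sum"
    "HOL-Library.Nat_Bijection"
    "HOL-Library.Extended_Real"
begin

section \<open>Type-2 computability on Baire space\<close>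

text \<open>
  Programs are descriptions of partial recursive functions with an oracle in
  \<open>nat \<Rightarrow> nat\<close>, the infinite input of a Type-2 machine. \<^term>\<open>Query\<close> reads the input at a
  computed position. Argument lists may be longer than needed; surplus arguments are ignored.
\<close>

datatype prog =
    Zero
  | Succ
  | Proj nat
  | Query
  | Comp prog "prog list"
  | Prec prog prog
  | Mu prog

inductive evals :: "(nat \<Rightarrow> nat) \<Rightarrow> prog \<Rightarrow> nat list \<Rightarrow> nat \<Rightarrow> bool" for p where
  Zero: "evals p Zero xs 0"
| Succ: "evals p Succ (x # xs) (Suc x)"
| Proj: "i < length xs \<Longrightarrow> evals p (Proj i) xs (xs ! i)"
| Query: "evals p Query (x # xs) (p x)"
| Comp: "list_all2 (\<lambda>Q y. evals p Q xs y) Qs ys \<Longrightarrow> evals p P ys z \<Longrightarrow> evals p (Comp P Qs) xs z"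
| Prec_0: "evals p P xs y \<Longrightarrow> evals p (Prec P Q) (0 # xs) y"
| Prec_Suc: "evals p (Prec P Q) (n # xs) y \<Longrightarrow> evals p Q (n # y # xs) z \<Longrightarrow>
    evals p (Prec P Q) (Suc n # xs) z"
| Mu: "evals p P (n # xs) 0 \<Longrightarrow> \<forall>m<n. \<exists>y. evals p P (m # xs) (Suc y) \<Longrightarrow> evals p (Mu P) xs n"

inductive_cases evals_cases:
  "evals p Zero xs z" "evals p Succ xs z" "evals p (Proj i) xs z" "evals p Query xs z"
  "evals p (Comp P Qs) xs z" "evals p (Prec P Q) (0 # xs) z" "evals p (Prec P Q) (Suc n # xs) z"
  "evals p (Mu P) xs z"

lemma evals_deterministic: "evals p P xs y \<Longrightarrow> evals p P xs z \<Longrightarrow> y = z"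
proof (induction arbitrary: z rule: evals.induct)
  case (Comp xs Qs ys P w)
  from Comp.prems obtain ys' where
    ys': "list_all2 (\<lambda>Q y. evals p Q xs y) Qs ys'" "evals p P ys' z"
    by (elim evals_cases)
  have "ys = ys'"
    using Comp.IH(1) ys'(1)
    by (simp add: list_all2_conv_all_nth list_eq_iff_nth_eq)
  then show ?case using Comp.IH(2) ys'(2) by simp
next
  case (Prec_Suc P Q n xs y w)
  from Prec_Suc.prems obtain y' where "evals p (Prec P Q) (n # xs) y'" "evals p Q (n # y' # xs) z"
    by (elim evals_cases)
  then show ?case using Prec_Suc.IH by blast
next
  case (Mu P n xs)
  from Mu.prems have z: "evals p P (z # xs) 0" "\<forall>m<z. \<exists>y. evals p P (m # xs) (Suc y)"
    by (elim evals_cases; blast)+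
  show ?case
  proof (cases n z rule: linorder_cases)
    case less
    then obtain y where "evals p P (n # xs) (Suc y)" using z(2) by blast
    then show ?thesis using Mu.IH(1) by fastforce
  next
    case greater
    then show ?thesis using Mu.IH(2) z(1) by fastforce
  qed
qed (elim evals_cases; simp)+

text \<open>On input \<open>p\<close>, the program produces the whole infinite output \<open>q\<close>.\<close>

definition outputs :: "prog \<Rightarrow> (nat \<Rightarrow> nat) \<Rightarrow> (nat \<Rightarrow> nat) \<Rightarrow> bool" where
  "outputs P p q \<longleftrightarrow> (\<forall>n. evals p P [n] (q n))"


section \<open>Represented spaces\<close>

text \<open>A representation is given by its graph: \<open>\<delta> p x\<close> means that \<open>p\<close> is a name of \<open>x\<close>.\<close>

type_synonym 'x representation = "(nat \<Rightarrow> nat) \<Rightarrow> 'x \<Rightarrow> bool"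

text \<open>
  The codomain representation may depend on the argument, so that one can speak about a sequence
  \<open>x i\<close> whose \<open>i\<close>-th member lives in the \<open>i\<close>-th of a sequence of represented spaces.
\<close>

definition computable_map ::
    "'x representation \<Rightarrow> ('x \<Rightarrow> 'y representation) \<Rightarrow> ('x \<Rightarrow> 'y) \<Rightarrow> bool" where
  "computable_map \<delta> \<delta>' f \<longleftrightarrow> (\<exists>P. \<forall>p x. \<delta> p x \<longrightarrow> (\<exists>q. outputs P p q \<and> \<delta>' x q (f x)))"

definition nat_rep :: "nat representation" where
  "nat_rep p n \<longleftrightarrow> p 0 = n"

definition prod_rep ::
    "'x representation \<Rightarrow> 'y representation \<Rightarrow> ('x \<times> 'y) representation" where
  "prod_rep \<delta> \<delta>' p z \<longleftrightarrow> \<delta> (\<lambda>n. p (2 * n)) (fst z) \<and> \<delta>' (\<lambda>n. p (2 * n + 1)) (snd z)"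

text \<open>
  Continuous partial functions on Baire space are coded by associates (Kleene's second algebra):
  applied to \<open>q\<close>, the function coded by \<open>r\<close> yields \<open>q'\<close>, where \<open>q' n\<close> is determined by the
  first prefix of \<open>q\<close> on which \<open>r\<close> gives an answer (answers are shifted by one).
\<close>

definition assoc_app :: "(nat \<Rightarrow> nat) \<Rightarrow> (nat \<Rightarrow> nat) \<Rightarrow> (nat \<Rightarrow> nat) \<Rightarrow> bool" where
  "assoc_app r q q' \<longleftrightarrow>
    (\<forall>n. \<exists>k. r (list_encode (n # map q [0..<k])) = Suc (q' n) \<and>
             (\<forall>j<k. r (list_encode (n # map q [0..<j])) = 0))"

text \<open>
  The representation \<open>[\<delta> \<rightarrow> \<delta>']\<close>. Functions with domain a proper subset of the type \<open>'x\<close> are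
  handled by \<open>\<delta>\<close> having names for the elements of this subset only.
\<close>

definition fun_rep ::
    "'x representation \<Rightarrow> 'y representation \<Rightarrow> ('x \<Rightarrow> 'y) representation" where
  "fun_rep \<delta> \<delta>' r f \<longleftrightarrow> (\<forall>p x. \<delta> p x \<longrightarrow> (\<exists>q. assoc_app r p q \<and> \<delta>' q (f x)))"

definition cauchy_rep ::
    "'x set \<Rightarrow> ('x \<Rightarrow> 'x \<Rightarrow> real) \<Rightarrow> (nat \<Rightarrow> 'x) \<Rightarrow> 'x representation" where
  "cauchy_rep X d \<alpha> p x \<longleftrightarrow> x \<in> X \<and>
    (\<forall>k l. k < l \<longrightarrow> d (\<alpha> (p k)) (\<alpha> (p l)) < (1 / 2) ^ k) \<and>
    (\<lambda>k. d (\<alpha> (p k)) x) \<longlonglongrightarrow> 0"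

definition rat_enum :: "nat \<Rightarrow> real" where
  "rat_enum n = (case prod_decode n of (a, m) \<Rightarrow> case prod_decode m of (b, c) \<Rightarrow>
     (real a - real b) / (real c + 1))"

definition real_rep :: "real representation" where
  "real_rep = cauchy_rep UNIV dist rat_enum"


section \<open>Hilbert spaces over the real or complex numbers\<close>

text \<open>
  The scalar field \<open>F\<close> is \<open>\<real>\<close> or \<open>UNIV\<close>, as a set of complex numbers. Spaces have explicit
  carriers, so that the members of a sequence of different Hilbert spaces can be accommodated in
  one type. The fields \<open>mult\<close> and \<open>one\<close> that the module record inherits from rings
  play no role.
\<close>

definition scalars :: "complex set \<Rightarrow> complex ring" where
  "scalars F = \<lparr>carrier = F, monoid.mult = (*), one = 1, zero = 0, add = (+)\<rparr>"

record 'a ip_space = "(complex, 'a) module" +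
  ip :: "'a \<Rightarrow> 'a \<Rightarrow> complex"

definition hnorm :: "'a ip_space \<Rightarrow> 'a \<Rightarrow> real" where
  "hnorm H x = sqrt (Re (ip H x x))"

definition hdist :: "'a ip_space \<Rightarrow> 'a \<Rightarrow> 'a \<Rightarrow> real" where
  "hdist H x y = hnorm H (x \<ominus>\<^bsub>H\<^esub> y)"

locale hilbert_space = Module.module "scalars F" H
  for F :: "complex set" and H :: "'a ip_space" +
  assumes scalar_field: "F = \<real> \<or> F = UNIV"
    and ip_closed: "\<lbrakk>x \<in> carrier H; y \<in> carrier H\<rbrakk> \<Longrightarrow> ip H x y \<in> F"
    and ip_add_left: "\<lbrakk>x \<in> carrier H; y \<in> carrier H; z \<in> carrier H\<rbrakk> \<Longrightarrow>
      ip H (x \<oplus>\<^bsub>H\<^esub> y) z = ip H x z + ip H y z"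
    and ip_smult_left: "\<lbrakk>c \<in> F; x \<in> carrier H; y \<in> carrier H\<rbrakk> \<Longrightarrow>
      ip H (c \<odot>\<^bsub>H\<^esub> x) y = c * ip H x y"
    and ip_commute: "\<lbrakk>x \<in> carrier H; y \<in> carrier H\<rbrakk> \<Longrightarrow> ip H y x = cnj (ip H x y)"
    and ip_pos: "\<lbrakk>x \<in> carrier H; x \<noteq> \<zero>\<^bsub>H\<^esub>\<rbrakk> \<Longrightarrow> 0 < Re (ip H x x)"
    and complete: "\<lbrakk>range s \<subseteq> carrier H;
        \<And>\<epsilon>. 0 < \<epsilon> \<Longrightarrow> \<exists>N. \<forall>m\<ge>N. \<forall>n\<ge>N. hdist H (s m) (s n) < \<epsilon>\<rbrakk> \<Longrightarrow>
      \<exists>x\<in>carrier H. (\<lambda>n. hdist H (s n) x) \<longlonglongrightarrow> 0"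

text \<open>\<open>L(H, K)\<close>\<close>

definition bounded_operator ::
    "complex set \<Rightarrow> 'a ip_space \<Rightarrow> 'b ip_space \<Rightarrow> ('a \<Rightarrow> 'b) \<Rightarrow> bool" where
  "bounded_operator F H K T \<longleftrightarrow>
     T \<in> carrier H \<rightarrow> carrier K \<and>
     (\<forall>x\<in>carrier H. \<forall>y\<in>carrier H. T (x \<oplus>\<^bsub>H\<^esub> y) = T x \<oplus>\<^bsub>K\<^esub> T y) \<and>
     (\<forall>c\<in>F. \<forall>x\<in>carrier H. T (c \<odot>\<^bsub>H\<^esub> x) = c \<odot>\<^bsub>K\<^esub> T x) \<and>
     (\<exists>C. \<forall>x\<in>carrier H. hnorm K (T x) \<le> C * hnorm H x)"

definition adjoint :: "'a ip_space \<Rightarrow> 'b ip_space \<Rightarrow> ('a \<Rightarrow> 'b) \<Rightarrow> 'b \<Rightarrow> 'a" where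
  "adjoint H K T y = (THE z. z \<in> carrier H \<and> (\<forall>x\<in>carrier H. ip K (T x) y = ip H x z))"


section \<open>Computable Hilbert spaces\<close>

text \<open>For \<open>F = \<real>\<close> the coefficients range over \<open>\<rat>\<close>, otherwise over \<open>\<rat> + \<i>\<rat>\<close>.\<close>

definition scalar_enum :: "complex set \<Rightarrow> nat \<Rightarrow> complex" where
  "scalar_enum F n =
    (if F = \<real> then of_real (rat_enum n)
     else case prod_decode n of (a, b) \<Rightarrow> Complex (rat_enum a) (rat_enum b))"

definition lin_comb :: "'a ip_space \<Rightarrow> (nat \<Rightarrow> 'a) \<Rightarrow> complex list \<Rightarrow> 'a" where
  "lin_comb H e cs = (\<Oplus>\<^bsub>H\<^esub>i\<in>{..<length cs}. (cs ! i) \<odot>\<^bsub>H\<^esub> e i)"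

definition comb_enum :: "complex set \<Rightarrow> 'a ip_space \<Rightarrow> (nat \<Rightarrow> 'a) \<Rightarrow> nat \<Rightarrow> 'a" where
  "comb_enum F H e n = lin_comb H e (map (scalar_enum F) (list_decode n))"

definition hilbert_rep :: "complex set \<Rightarrow> 'a ip_space \<Rightarrow> (nat \<Rightarrow> 'a) \<Rightarrow> 'a representation" where
  "hilbert_rep F H e = cauchy_rep (carrier H) (hdist H) (comb_enum F H e)"

definition fundamental_sequence :: "complex set \<Rightarrow> 'a ip_space \<Rightarrow> (nat \<Rightarrow> 'a) \<Rightarrow> bool" where
  "fundamental_sequence F H e \<longleftrightarrow> range e \<subseteq> carrier H \<and>
    (\<forall>x\<in>carrier H. \<forall>\<epsilon>>0. \<exists>cs. set cs \<subseteq> F \<and> hdist H (lin_comb H e cs) x < \<epsilon>)"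

definition computable_hilbert_space ::
    "complex set \<Rightarrow> 'a ip_space \<Rightarrow> (nat \<Rightarrow> 'a) \<Rightarrow> bool" where
  "computable_hilbert_space F H e \<longleftrightarrow>
     hilbert_space F H \<and> fundamental_sequence F H e \<and>
     computable_map (prod_rep nat_rep nat_rep) (\<lambda>_. real_rep)
       (\<lambda>(n, m). hdist H (comb_enum F H e n) (comb_enum F H e m))"

text \<open>In a sequence of computable Hilbert spaces the metrics are computable uniformly in the index.\<close>

definition computable_hilbert_space_seq ::
    "complex set \<Rightarrow> (nat \<Rightarrow> 'a ip_space) \<Rightarrow> (nat \<Rightarrow> nat \<Rightarrow> 'a) \<Rightarrow> bool" where
  "computable_hilbert_space_seq F K e \<longleftrightarrow>
     (\<forall>i. computable_hilbert_space F (K i) (e i)) \<and>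
     computable_map (prod_rep nat_rep (prod_rep nat_rep nat_rep)) (\<lambda>_. real_rep)
       (\<lambda>(i, n, m). hdist (K i) (comb_enum F (K i) (e i) n) (comb_enum F (K i) (e i) m))"


section \<open>Frames and g-frames\<close>

text \<open>
  The index type \<open>'j\<close> is \<open>nat\<close> or \<open>nat \<times> nat\<close>. The sum has nonnegative terms, so the order of
  summation is immaterial.
\<close>

definition frame_with_bounds :: "'a ip_space \<Rightarrow> ('j \<Rightarrow> 'a) \<Rightarrow> real \<Rightarrow> real \<Rightarrow> bool" where
  "frame_with_bounds H f A B \<longleftrightarrow> 0 < A \<and> A \<le> B \<and> range f \<subseteq> carrier H \<and>
    (\<forall>x\<in>carrier H.
       (\<lambda>k. (cmod (ip H x (f k)))\<^sup>2) summable_on UNIV \<and>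
       A * (hnorm H x)\<^sup>2 \<le> (\<Sum>\<^sub>\<infinity>k. (cmod (ip H x (f k)))\<^sup>2) \<and>
       (\<Sum>\<^sub>\<infinity>k. (cmod (ip H x (f k)))\<^sup>2) \<le> B * (hnorm H x)\<^sup>2)"

definition computable_frame ::
    "'j representation \<Rightarrow> complex set \<Rightarrow> 'a ip_space \<Rightarrow> (nat \<Rightarrow> 'a) \<Rightarrow> ('j \<Rightarrow> 'a) \<Rightarrow> bool" where
  "computable_frame \<iota> F H e f \<longleftrightarrow>
     (\<exists>A B. frame_with_bounds H f A B) \<and> computable_map \<iota> (\<lambda>_. hilbert_rep F H e) f"

definition g_frame ::
    "complex set \<Rightarrow> 'a ip_space \<Rightarrow> (nat \<Rightarrow> 'b ip_space) \<Rightarrow> (nat \<Rightarrow> 'a \<Rightarrow> 'b) \<Rightarrow> bool" where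
  "g_frame F H K \<Lambda> \<longleftrightarrow> (\<forall>i. bounded_operator F H (K i) (\<Lambda> i)) \<and>
    (\<exists>A B. 0 < A \<and> A \<le> B \<and>
      (\<forall>x\<in>carrier H.
         (\<lambda>i. (hnorm (K i) (\<Lambda> i x))\<^sup>2) summable_on UNIV \<and>
         A * (hnorm H x)\<^sup>2 \<le> (\<Sum>\<^sub>\<infinity>i. (hnorm (K i) (\<Lambda> i x))\<^sup>2) \<and>
         (\<Sum>\<^sub>\<infinity>i. (hnorm (K i) (\<Lambda> i x))\<^sup>2) \<le> B * (hnorm H x)\<^sup>2))"

definition computable_g_frame ::
    "complex set \<Rightarrow> 'a ip_space \<Rightarrow> (nat \<Rightarrow> 'a) \<Rightarrow> (nat \<Rightarrow> 'b ip_space) \<Rightarrow> (nat \<Rightarrow> nat \<Rightarrow> 'b) \<Rightarrow>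
      (nat \<Rightarrow> 'a \<Rightarrow> 'b) \<Rightarrow> bool" where
  "computable_g_frame F H e K d \<Lambda> \<longleftrightarrow> g_frame F H K \<Lambda> \<and>
     computable_map nat_rep
       (\<lambda>i. fun_rep (hilbert_rep F H e) (hilbert_rep F (K i) (d i))) \<Lambda>"

end

theory Submission
  imports Defs
begin

text \<open>
  Let \<open>z = \<Lambda>\<^sub>i\<^sup>* g\<^sub>i\<^sub>j\<close>. For a rational combination \<open>x\<close> put \<open>u = \<Lambda>\<^sub>i x\<close> and \<open>v = g\<^sub>i\<^sub>j\<close>. Since \<open>\<langle>x, z\<rangle> = \<langle>u, v\<rangle>\<close>,
  polarization gives \<open>\<parallel>x - z\<parallel>\<^sup>2 = \<parallel>x\<parallel>\<^sup>2 + \<parallel>z\<parallel>\<^sup>2 + \<parallel>u - v\<parallel>\<^sup>2 - \<parallel>u\<parallel>\<^sup>2 - \<parallel>v\<parallel>\<^sup>2\<close>, in which every term is computable: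
  \<open>\<parallel>z\<parallel>\<close> by hypothesis and the others from the computable metrics. So an unbounded search for \<open>x\<close> with
  \<open>\<parallel>x - z\<parallel> < 2^(-k-1)\<close>, which succeeds by density, computes a name of \<open>z\<close>. The frame
  inequalities follow by summing \<open>A\<^sub>i \<parallel>\<Lambda>\<^sub>i x\<parallel>\<^sup>2 \<le> \<Sum>\<^sub>j |\<langle>\<Lambda>\<^sub>i x, g\<^sub>i\<^sub>j\<rangle>|\<^sup>2 \<le> B\<^sub>i \<parallel>\<Lambda>\<^sub>i x\<parallel>\<^sup>2\<close> over \<open>i\<close>.
\<close>

section \<open>Total recursive functions\<close>

text \<open>One program must serve every oracle \<open>p\<close>, so the value depends on the
  arguments alone. This is the form in which names are handled once they depend only on finitely
  many numbers.\<close>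

definition recursive :: "nat \<Rightarrow> (nat list \<Rightarrow> nat) \<Rightarrow> bool" where
  "recursive a f \<longleftrightarrow> (\<exists>P. \<forall>p xs. length xs = a \<longrightarrow> evals p P xs (f xs))"

named_theorems recursive_intros

lemma recursive_cong:
  assumes "recursive a f" "\<And>xs. length xs = a \<Longrightarrow> f xs = g xs"
  shows "recursive a g"
  using assms unfolding recursive_def by metis

lemma recursive_nth [recursive_intros]: "i < a \<Longrightarrow> recursive a (\<lambda>xs. xs ! i)"
  unfolding recursive_def by (metis evals.Proj)

lemma recursive_comp:
  assumes g: "recursive b g" and fs: "\<And>f. f \<in> set fs \<Longrightarrow> recursive a f" and b: "length fs = b"
  shows "recursive a (\<lambda>xs. g (map (\<lambda>f. f xs) fs))"
proof -
  obtain P where P: "\<And>p xs. length xs = b \<Longrightarrow> evals p P xs (g xs)"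
    using g unfolding recursive_def by blast
  have "\<forall>f\<in>set fs. \<exists>Q. \<forall>p xs. length xs = a \<longrightarrow> evals p Q xs (f xs)"
    using fs unfolding recursive_def by blast
  then obtain Q where Q: "\<And>f p xs. \<lbrakk>f \<in> set fs; length xs = a\<rbrakk> \<Longrightarrow> evals p (Q f) xs (f xs)"
    by metis
  have "evals p (Comp P (map Q fs)) xs (g (map (\<lambda>f. f xs) fs))" if "length xs = a" for p xs
  proof (rule evals.Comp)
    show "list_all2 (\<lambda>Q y. evals p Q xs y) (map Q fs) (map (\<lambda>f. f xs) fs)"
      by (simp add: list_all2_conv_all_nth Q that)
  qed (simp add: P b)
  then show ?thesis unfolding recursive_def by blast
qed

lemma recursive_comp1:
  assumes "recursive 1 (\<lambda>xs. h (xs ! 0))" "recursive a f"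
  shows "recursive a (\<lambda>xs. h (f xs))"
  using recursive_comp[OF assms(1), of "[f]" a] assms(2) by simp

lemma recursive_comp2:
  assumes "recursive 2 (\<lambda>xs. h (xs ! 0) (xs ! 1))" "recursive a f" "recursive a g"
  shows "recursive a (\<lambda>xs. h (f xs) (g xs))"
  using recursive_comp[OF assms(1), of "[f, g]" a] assms(2,3) by auto

text \<open>Families of names are carried as \<open>s t ps\<close>, the position first and the
  number parameters in a list. This lemma and its two variants substitute recursive functions for
  the position and the parameters.\<close>

lemma recursive_app1:
  assumes "recursive 2 (\<lambda>ys. s (ys ! 0) (tl ys))" "recursive a f" "recursive a g"
  shows "recursive a (\<lambda>xs. s (f xs) [g xs])"
  using recursive_comp[OF assms(1), of "[f, g]" a] assms(2,3) by auto

lemma recursive_app2: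
  assumes "recursive 3 (\<lambda>ys. s (ys ! 0) (tl ys))" "recursive a f" "recursive a g" "recursive a h"
  shows "recursive a (\<lambda>xs. s (f xs) [g xs, h xs])"
  using recursive_comp[OF assms(1), of "[f, g, h]" a] assms(2-) by auto

lemma recursive_app3:
  assumes "recursive 4 (\<lambda>ys. s (ys ! 0) (tl ys))" "recursive a f" "recursive a g" "recursive a h" "recursive a k"
  shows "recursive a (\<lambda>xs. s (f xs) [g xs, h xs, k xs])"
  using recursive_comp[OF assms(1), of "[f, g, h, k]" a] assms(2-) by auto

lemma recursive_0: "recursive a (\<lambda>_. 0)"
  unfolding recursive_def by (blast intro: evals.Zero)

lemma recursive_Suc [recursive_intros]: "recursive a f \<Longrightarrow> recursive a (\<lambda>xs. Suc (f xs))"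
proof (rule recursive_comp1[of Suc])
  have "evals p Succ xs (Suc (xs ! 0))" if "length xs = 1" for p xs
    using that evals.Succ by (cases xs) auto
  then show "recursive 1 (\<lambda>xs. Suc (xs ! 0))"
    unfolding recursive_def by blast
qed

lemma recursive_const [recursive_intros]: "recursive a (\<lambda>_. c)"
  by (induction c) (auto intro: recursive_0 recursive_Suc)

lemma recursive_rec_nat:
  assumes "recursive a f" "recursive (Suc (Suc a)) (\<lambda>ys. s (ys ! 0) (ys ! 1) (drop 2 ys))"
  shows "recursive (Suc a) (\<lambda>xs. rec_nat (f (tl xs)) (\<lambda>n y. s n y (tl xs)) (xs ! 0))"
proof -
  obtain P where P: "\<And>p xs. length xs = a \<Longrightarrow> evals p P xs (f xs)"
    using assms(1) unfolding recursive_def by blast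
  obtain Q where Q: "\<And>p ys. length ys = Suc (Suc a) \<Longrightarrow> evals p Q ys (s (ys ! 0) (ys ! 1) (drop 2 ys))"
    using assms(2) unfolding recursive_def by blast
  have Q': "evals p Q (n # y # xs) (s n y xs)" if "length xs = a" for p n y xs
    using Q[of "n # y # xs" p] that by simp
  have "evals p (Prec P Q) (n # xs) (rec_nat (f xs) (\<lambda>n y. s n y xs) n)" if "length xs = a" for p n xs
    by (induction n) (auto intro: evals.Prec_0 evals.Prec_Suc P Q' that)
  then have "evals p (Prec P Q) xs (rec_nat (f (tl xs)) (\<lambda>n y. s n y (tl xs)) (xs ! 0))"
    if "length xs = Suc a" for p xs
    using that by (cases xs) auto
  then show ?thesis unfolding recursive_def by blast
qed

text \<open>Since \<open>f\<close> is total and has a zero for all parameters, every value before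
  the first zero is a defined successor, which is exactly what \<open>Mu\<close> demands.\<close>

lemma recursive_Least:
  assumes "recursive (Suc a) (\<lambda>ys. f (ys ! 0) (tl ys))" "\<And>xs. length xs = a \<Longrightarrow> \<exists>n. f n xs = 0"
  shows "recursive a (\<lambda>xs. LEAST n. f n xs = 0)"
proof -
  obtain P where P: "\<And>p ys. length ys = Suc a \<Longrightarrow> evals p P ys (f (ys ! 0) (tl ys))"
    using assms(1) unfolding recursive_def by blast
  have "evals p (Mu P) xs (LEAST n. f n xs = 0)" if xs: "length xs = a" for p xs
  proof (rule evals.Mu)
    have P': "evals p P (n # xs) (f n xs)" for n
      using P[of "n # xs" p] xs by simp
    have "f (LEAST n. f n xs = 0) xs = 0"
      using assms(2)[OF xs] by (rule LeastI_ex)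
    then show "evals p P ((LEAST n. f n xs = 0) # xs) 0"
      by (metis P')
    show "\<forall>m<LEAST n. f n xs = 0. \<exists>y. evals p P (m # xs) (Suc y)"
      by (metis P' not_less_Least old.nat.exhaust)
  qed
  then show ?thesis unfolding recursive_def by blast
qed

lemma recursive_nth_tl [recursive_intros]: "Suc i < a \<Longrightarrow> recursive a (\<lambda>xs. tl xs ! i)"
  by (rule recursive_cong[OF recursive_nth[of "Suc i"]]) (auto simp: nth_tl)

lemma recursive_nth_drop [recursive_intros]: "k + i < a \<Longrightarrow> recursive a (\<lambda>xs. drop k xs ! i)"
  by (rule recursive_cong[OF recursive_nth[of "k + i"]]) auto

section \<open>Arithmetic on natural numbers\<close>

lemma recursive_add [recursive_intros]:
  "recursive a f \<Longrightarrow> recursive a g \<Longrightarrow> recursive a (\<lambda>xs. f xs + g xs)"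
proof (rule recursive_comp2[of "(+)"])
  have "rec_nat m (\<lambda>_. Suc) n = n + m" for m n :: nat
    by (induction n) auto
  moreover have "recursive 2 (\<lambda>xs. rec_nat (tl xs ! 0) (\<lambda>n y. Suc y) (xs ! 0))"
    unfolding numeral_2_eq_2 by (rule recursive_rec_nat[where f = "\<lambda>xs. xs ! 0" and s = "\<lambda>n y xs. Suc y"])
      (intro recursive_intros; simp)+
  ultimately show "recursive 2 (\<lambda>xs. xs ! 0 + xs ! 1)"
    by (elim recursive_cong) (simp add: nth_tl)
qed

lemma recursive_mult [recursive_intros]:
  "recursive a f \<Longrightarrow> recursive a g \<Longrightarrow> recursive a (\<lambda>xs. f xs * g xs)"
proof (rule recursive_comp2[of "(*)"])
  have "rec_nat 0 (\<lambda>_ y. y + m) n = n * m" for m n :: nat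
    by (induction n) auto
  moreover have "recursive 2 (\<lambda>xs. rec_nat 0 (\<lambda>n y. y + tl xs ! 0) (xs ! 0))"
    unfolding numeral_2_eq_2
    by (rule recursive_rec_nat[where f = "\<lambda>_. 0" and s = "\<lambda>n y xs. y + xs ! 0"])
      (intro recursive_intros; simp)+
  ultimately show "recursive 2 (\<lambda>xs. xs ! 0 * xs ! 1)"
    by (elim recursive_cong) (simp add: nth_tl)
qed

lemma recursive_diff [recursive_intros]:
  "recursive a f \<Longrightarrow> recursive a g \<Longrightarrow> recursive a (\<lambda>xs. f xs - g xs)"
proof (rule recursive_comp2[of "\<lambda>x y. x - y"])
  have *: "rec_nat 0 (\<lambda>n _. n) n = n - 1" for n :: nat
    by (cases n) auto
  have "recursive 1 (\<lambda>xs. rec_nat 0 (\<lambda>n y. n) (xs ! 0))"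
    unfolding One_nat_def
    by (rule recursive_rec_nat[where f = "\<lambda>_. 0" and s = "\<lambda>n y xs. n"])
      (intro recursive_intros; simp)+
  then have pred: "recursive a (\<lambda>xs. f xs - 1)" if "recursive a f" for a f
    using recursive_comp1[of "\<lambda>x. x - 1"] that by (simp add: *)
  have "rec_nat m (\<lambda>_ y. y - 1) n = m - n" for m n :: nat
    by (induction n) auto
  moreover have "recursive 2 (\<lambda>xs. rec_nat (tl xs ! 0) (\<lambda>n y. y - 1) (xs ! 0))"
    unfolding numeral_2_eq_2
    by (rule recursive_rec_nat[where f = "\<lambda>xs. xs ! 0" and s = "\<lambda>n y xs. y - 1"])
      (intro recursive_intros pred; simp)+
  \<comment> \<open>Primitive recursion runs on the first argument, which here has to be the
    subtrahend; the arguments are swapped afterwards.\<close>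
  ultimately have "recursive 2 (\<lambda>xs. xs ! 1 - xs ! 0)"
    by (elim recursive_cong) (simp add: nth_tl)
  then have "recursive 2 (\<lambda>xs. (\<lambda>x y. y - x) (xs ! 1) (xs ! 0))"
    by (rule recursive_comp2) (intro recursive_intros; simp)+
  then show "recursive 2 (\<lambda>xs. xs ! 0 - xs ! 1)"
    by simp
qed

lemma recursive_if [recursive_intros]:
  assumes "recursive a c" "recursive a f" "recursive a g"
  shows "recursive a (\<lambda>xs. if c xs = 0 then f xs else g xs)"
proof -
  \<comment> \<open>Under truncated subtraction \<open>1 - c xs\<close> is the indicator of
    \<open>c xs = 0\<close>.\<close>
  have "recursive a (\<lambda>xs. (1 - c xs) * f xs + (1 - (1 - c xs)) * g xs)"
    by (intro recursive_intros assms)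
  then show ?thesis
    by (rule recursive_cong) auto
qed

lemma recursive_power [recursive_intros]:
  "recursive a f \<Longrightarrow> recursive a (\<lambda>xs. c ^ f xs)"
proof (rule recursive_comp1[of "\<lambda>n. c ^ n"])
  have "rec_nat 1 (\<lambda>_ y. c * y) n = c ^ n" for n :: nat
    by (induction n) auto
  moreover have "recursive 1 (\<lambda>xs. rec_nat 1 (\<lambda>n y. c * y) (xs ! 0))"
    unfolding One_nat_def
    by (rule recursive_rec_nat[where f = "\<lambda>_. Suc 0" and s = "\<lambda>n y xs. c * y"])
      (intro recursive_intros; simp)+
  ultimately show "recursive 1 (\<lambda>xs. c ^ (xs ! 0))"
    by simp
qed

lemma recursive_div [recursive_intros]:
  assumes "recursive a f" "recursive a g" "\<And>xs. length xs = a \<Longrightarrow> 0 < g xs"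
  shows "recursive a (\<lambda>xs. f xs div g xs)"
proof -
  \<comment> \<open>The condition \<open>Suc x - Suc q * y = 0\<close> says
    \<open>x < Suc q * y\<close>, and the least such \<open>q\<close> is the quotient.\<close>
  have *: "(LEAST q. Suc x - Suc q * y = 0) = x div y" if "0 < y" for x y :: nat
  proof (rule Least_equality)
    show "Suc x - Suc (x div y) * y = 0"
      using dividend_less_div_times[OF that, of x] by simp
    fix q assume "Suc x - Suc q * y = 0"
    then have "x < Suc q * y" by simp
    then show "x div y \<le> q"
      using less_Suc_eq_le less_mult_imp_div_less by blast
  qed
  \<comment> \<open>Dividing by \<open>Suc (xs ! 1)\<close> makes the search halt on all arguments;
    inserting \<open>g xs - 1\<close> recovers the divisor because it is positive.\<close>
  have "recursive 2 (\<lambda>xs. LEAST q. Suc (xs ! 0) - Suc q * Suc (xs ! 1) = 0)"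
  proof (rule recursive_Least)
    show "recursive (Suc 2) (\<lambda>ys. Suc (tl ys ! 0) - Suc (ys ! 0) * Suc (tl ys ! 1))"
      by (intro recursive_intros; simp)
    show "\<exists>q. Suc (xs ! 0) - Suc q * Suc (xs ! 1) = 0" for xs :: "nat list"
      by (rule exI[of _ "xs ! 0"]) simp
  qed
  then have "recursive a (\<lambda>xs. LEAST q. Suc (f xs) - Suc q * Suc (g xs - 1) = 0)"
    by (rule recursive_comp2) (intro recursive_intros assms)+
  then show ?thesis
    by (rule recursive_cong) (use * assms(3) in auto)
qed

lemma recursive_triangle [recursive_intros]: "recursive a f \<Longrightarrow> recursive a (\<lambda>xs. triangle (f xs))"
proof (rule recursive_comp1[of triangle])
  have "rec_nat 0 (\<lambda>n y. y + Suc n) n = triangle n" for n :: nat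
    by (induction n) auto
  moreover have "recursive 1 (\<lambda>xs. rec_nat 0 (\<lambda>n y. y + Suc n) (xs ! 0))"
    unfolding One_nat_def
    by (rule recursive_rec_nat[where f = "\<lambda>_. 0" and s = "\<lambda>n y xs. y + Suc n"])
      (intro recursive_intros; simp)+
  ultimately show "recursive 1 (\<lambda>xs. triangle (xs ! 0))"
    by simp
qed

section \<open>Cantor pairing and list codes\<close>

lemma recursive_prod_encode [recursive_intros]:
  "recursive a f \<Longrightarrow> recursive a g \<Longrightarrow> recursive a (\<lambda>xs. prod_encode (f xs, g xs))"
  by (simp add: prod_encode_def, intro recursive_intros)

text \<open>The code of \<open>(x, y)\<close> is \<open>triangle (x + y) + x\<close>. Hence
  \<open>x + y\<close> is the least \<open>s\<close> for which \<open>triangle (Suc s)\<close>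
  exceeds the code, and both components follow by subtraction.\<close>

lemma recursive_prod_decode [recursive_intros]:
  assumes "recursive a f"
  shows "recursive a (\<lambda>xs. fst (prod_decode (f xs)))" "recursive a (\<lambda>xs. snd (prod_decode (f xs)))"
proof -
  define s where "s x = (LEAST s. Suc x - triangle (Suc s) = 0)" for x
  have mono: "triangle m \<le> triangle n" if "m \<le> n" for m n
    using that by (induction n rule: dec_induct) auto
  have s: "s (prod_encode (x, y)) = x + y" for x y
    unfolding s_def
  proof (rule Least_equality)
    show "Suc (prod_encode (x, y)) - triangle (Suc (x + y)) = 0"
      by (simp add: prod_encode_def)
    fix t assume "Suc (prod_encode (x, y)) - triangle (Suc t) = 0"
    then have "triangle (x + y) < triangle (Suc t)"
      unfolding prod_encode_def by simp
    then show "x + y \<le> t"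
      using mono[of "Suc t" "x + y"] by (meson leD not_less_eq_eq)
  qed
  have fst: "fst (prod_decode x) = x - triangle (s x)" 
    and snd: "snd (prod_decode x) = s x - fst (prod_decode x)" for x
    using s[of "fst (prod_decode x)" "snd (prod_decode x)"]
      prod_decode_inverse[of x] unfolding prod_encode_def
    by (auto simp: case_prod_beta)
  have "recursive 1 (\<lambda>xs. LEAST s. Suc (xs ! 0) - triangle (Suc s) = 0)"
  proof (rule recursive_Least)
    show "recursive (Suc 1) (\<lambda>ys. Suc (tl ys ! 0) - triangle (Suc (ys ! 0)))"
      by (intro recursive_intros; simp)
    show "\<exists>s. Suc (xs ! 0) - triangle (Suc s) = 0" for xs :: "nat list"
      by (rule exI[of _ "xs ! 0"]) simp
  qed
  from recursive_comp1[OF this assms]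
  have "recursive a (\<lambda>xs. s (f xs))"
    by (simp add: s_def)
  with assms show *: "recursive a (\<lambda>xs. fst (prod_decode (f xs)))"
    unfolding fst by (intro recursive_intros)
  with \<open>recursive a (\<lambda>xs. s (f xs))\<close> show "recursive a (\<lambda>xs. snd (prod_decode (f xs)))"
    unfolding snd by (intro recursive_intros)
qed

lemma recursive_list_encode_Cons [recursive_intros]:
  "recursive a f \<Longrightarrow> recursive a (\<lambda>xs. list_encode (g xs)) \<Longrightarrow>
    recursive a (\<lambda>xs. list_encode (f xs # g xs))"
  by (simp, intro recursive_intros)

text \<open>These lists are the prefixes of a constant name, at whose codes an associate gets
  evaluated.\<close>

lemma recursive_list_encode_replicate [recursive_intros]:
  "recursive a f \<Longrightarrow> recursive a g \<Longrightarrow> recursive a (\<lambda>xs. list_encode (replicate (f xs) (g xs)))"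
proof (rule recursive_comp2[of "\<lambda>k n. list_encode (replicate k n)"])
  have "rec_nat 0 (\<lambda>_ y. Suc (prod_encode (n, y))) k = list_encode (replicate k n)" for k n
    by (induction k) auto
  moreover have "recursive 2 (\<lambda>xs. rec_nat 0 (\<lambda>_ y. Suc (prod_encode (tl xs ! 0, y))) (xs ! 0))"
    unfolding numeral_2_eq_2
    by (rule recursive_rec_nat[where f = "\<lambda>_. 0" and s = "\<lambda>_ y xs. Suc (prod_encode (xs ! 0, y))"])
      (intro recursive_intros; simp)+
  ultimately show "recursive 2 (\<lambda>xs. list_encode (replicate (xs ! 0) (xs ! 1)))"
    by (elim recursive_cong) (simp add: nth_tl)
qed


section \<open>Oracle substitution\<close>

text \<open>
  \<open>subst_oracle R b a P\<close> runs \<open>P\<close> on the first \<open>a\<close> arguments. The further \<open>b\<close> arguments are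
  parameters, which are passed on to \<open>R\<close> whenever \<open>P\<close> queries its oracle.
\<close>

fun subst_oracle :: "prog \<Rightarrow> nat \<Rightarrow> nat \<Rightarrow> prog \<Rightarrow> prog" where
  "subst_oracle R b a Query = Comp R (Proj 0 # map Proj [a..<a + b])"
| "subst_oracle R b a (Comp P Qs) =
    Comp (subst_oracle R b (length Qs) P) (map (subst_oracle R b a) Qs @ map Proj [a..<a + b])"
| "subst_oracle R b a (Prec P Q) =
    Prec (subst_oracle R b (a - 1) P) (subst_oracle R b (Suc a) Q)"
| "subst_oracle R b a (Mu P) = Mu (subst_oracle R b (Suc a) P)"
| "subst_oracle R b a P = P"

lemma list_all2_Proj:
  "list_all2 (\<lambda>Q y. evals p Q (xs @ ps) y) (map Proj [length xs..<length xs + length ps]) ps"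
proof -
  have "evals p (Proj (length xs + i)) (xs @ ps) (ps ! i)" if "i < length ps" for i
    using evals.Proj[of "length xs + i" "xs @ ps" p] that by simp
  then show ?thesis by (simp add: list_all2_conv_all_nth)
qed

text \<open>Since the parameters stand at the end, the proper arguments keep their indices, and by
  induction on the run only queries change: each one becomes a run of \<open>R\<close> on the
  queried position and \<open>ps\<close>.\<close>

lemma evals_subst_oracle:
  assumes "evals q P xs y" and R: "\<And>m. evals p R (m # ps) (q m)"
  shows "evals p (subst_oracle R (length ps) (length xs) P) (xs @ ps) y"
  using assms(1)
proof (induction rule: evals.induct)
  case (Proj i xs)
  then show ?case
    using evals.Proj[of i "xs @ ps" p] by (simp add: nth_append)
next
  case (Query x xs)
  have "list_all2 (\<lambda>Q y. evals p Q ((x # xs) @ ps) y)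
      (Proj 0 # map Proj [length (x # xs)..<length (x # xs) + length ps]) (x # ps)"
    using list_all2_Proj[of p "x # xs" ps] evals.Proj[of 0 "(x # xs) @ ps" p] by simp
  from evals.Comp[OF this R] show ?case by simp
next
  case (Comp xs Qs ys P z)
  have "length ys = length Qs"
    using Comp.IH(1) by (simp add: list_all2_lengthD)
  moreover have "list_all2 (\<lambda>Q y. evals p Q (xs @ ps) y)
      (map (subst_oracle R (length ps) (length xs)) Qs @ map Proj [length xs..<length xs + length ps])
      (ys @ ps)"
    using Comp.IH(1) list_all2_Proj[of p xs ps]
    by (intro list_all2_appendI) (simp_all add: list_all2_conv_all_nth)
  ultimately show ?case
    using Comp.IH(2) by (auto intro: evals.Comp)
qed (fastforce intro: evals.intros)+

text \<open>If the input names are recursive in finitely many number parameters, the oracle can be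
  computed instead of read. The realizer of \<open>f\<close> then becomes an ordinary recursive
  function of position and parameters.\<close>

lemma recursive_computable_map:
  assumes "computable_map \<delta> \<delta>' f" and "recursive (Suc b) (\<lambda>ys. r (ys ! 0) (tl ys))"
    and name: "\<And>ps. length ps = b \<Longrightarrow> \<delta> (\<lambda>m. r m ps) (x ps)"
  obtains s where "recursive (Suc b) (\<lambda>ys. s (ys ! 0) (tl ys))"
    and "\<And>ps. length ps = b \<Longrightarrow> \<delta>' (x ps) (\<lambda>m. s m ps) (f (x ps))"
proof -
  obtain P where P: "\<And>p x. \<delta> p x \<Longrightarrow> \<exists>q. outputs P p q \<and> \<delta>' x q (f x)"
    using assms(1) unfolding computable_map_def by blast
  obtain R where R: "\<And>p ys. length ys = Suc b \<Longrightarrow> evals p R ys (r (ys ! 0) (tl ys))"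
    using assms(2) unfolding recursive_def by blast
  have "\<forall>ps. \<exists>q. length ps = b \<longrightarrow> outputs P (\<lambda>m. r m ps) q \<and> \<delta>' (x ps) q (f (x ps))"
    using P name by blast
  then obtain s where s: "length ps = b \<Longrightarrow> outputs P (\<lambda>m. r m ps) (s ps)"
      "length ps = b \<Longrightarrow> \<delta>' (x ps) (s ps) (f (x ps))" for ps
    by metis
  have "evals p (subst_oracle R b 1 P) ys (s (tl ys) (ys ! 0))" if "length ys = Suc b" for p ys
  proof -
    obtain m ps where ys: "ys = m # ps" "length ps = b"
      using \<open>length ys = Suc b\<close> by (cases ys) auto
    have "evals p R (n # ps) (r n ps)" for n
      using R[of "n # ps" p] ys by simp
    with s(1)[OF ys(2)] have "evals p (subst_oracle R (length ps) (length [m]) P) ([m] @ ps) (s ps m)"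
      by (intro evals_subst_oracle) (auto simp: outputs_def)
    then show ?thesis using ys by simp
  qed
  then have "recursive (Suc b) (\<lambda>ys. s (tl ys) (ys ! 0))"
    unfolding recursive_def by blast
  with s(2) that[of "\<lambda>m ps. s ps m"] show thesis by blast
qed

lemma computable_map_recursive:
  assumes "recursive 3 (\<lambda>xs. s (xs ! 0) (xs ! 1) (xs ! 2))"
    and "\<And>i j. \<delta> (i, j) (s i j) (f (i, j))"
  shows "computable_map (prod_rep nat_rep nat_rep) \<delta> f"
proof -
  obtain P where P: "\<And>p xs. length xs = 3 \<Longrightarrow> evals p P xs (s (xs ! 0) (xs ! 1) (xs ! 2))"
    using assms(1) unfolding recursive_def by blast
  \<comment> \<open>Under \<open>prod_rep nat_rep nat_rep\<close> a name of \<open>(i, j)\<close>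
    holds \<open>i\<close> at position 0 and \<open>j\<close> at position 1.\<close>
  let ?P = "Comp P [Comp Query [Zero], Comp Query [Comp Succ [Zero]], Proj 0]"
  have *: "outputs ?P p (s (p 0) (p 1))" for p
  proof -
    have "evals p (Comp Query [Zero]) [n] (p 0)" for n
      by (rule evals.Comp[where ys = "[0]"]) (auto intro: evals.intros)
    moreover have "evals p (Comp Query [Comp Succ [Zero]]) [n] (p 1)" for n
      by (rule evals.Comp[where ys = "[1]"])
        (auto intro!: evals.intros(4) evals.Comp[where ys = "[0]"] evals.Zero simp: evals.Succ)
    moreover have "evals p (Proj 0) [n] n" for n
      using evals.Proj[of 0 "[n]" p] by simp
    ultimately show ?thesis
      using P[of "[p 0, p 1, n]" p for n] unfolding outputs_def
      by (intro allI evals.Comp[where ys = "[p 0, p 1, n]" for n]) auto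
  qed
  show ?thesis unfolding computable_map_def
  proof (intro exI[of _ ?P] allI impI)
    fix p z assume "prod_rep nat_rep nat_rep p z"
    then have "z = (p 0, p 1)"
      by (simp add: prod_rep_def nat_rep_def prod_eq_iff)
    with * assms(2) show "\<exists>q. outputs ?P p q \<and> \<delta> z q (f z)"
      by blast
  qed
qed

text \<open>Evaluation of the operators at elements with constant names: all prefixes of such a name
  are lists \<open>replicate k n\<close>, so the associate of \<open>\<Lambda> i\<close> can be run
  by searching for the first prefix length that it answers.\<close>

lemma recursive_fun_rep:
  assumes "computable_map nat_rep (\<lambda>i. fun_rep \<delta> (\<delta>' i)) \<Lambda>" and name: "\<And>n. \<delta> (\<lambda>_. n) (a n)"
  obtains u where "recursive 3 (\<lambda>ys. u (ys ! 0) (tl ys))"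
    and "\<And>i n. \<delta>' i (\<lambda>t. u t [i, n]) (\<Lambda> i (a n))"
proof -
  have "recursive (Suc 1) (\<lambda>ys. (\<lambda>_ ps. ps ! 0) (ys ! 0) (tl ys))"
    by (intro recursive_intros; simp)
  from recursive_computable_map[OF assms(1) this, of "\<lambda>ps. ps ! 0"]
  obtain r where r: "recursive 2 (\<lambda>ys. r (ys ! 0) (tl ys))"
    and rep: "\<And>ps. length ps = 1 \<Longrightarrow> fun_rep \<delta> (\<delta>' (ps ! 0)) (\<lambda>m. r m ps) (\<Lambda> (ps ! 0))"
    by (auto simp: nat_rep_def numeral_2_eq_2)
  define R where "R k t i n = r (list_encode (t # replicate k n)) [i]" for k t i n
  \<comment> \<open>\<open>1 - R\<close> vanishes precisely when the associate answers, that is,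
    when its value is positive.\<close>
  define L where "L xs = (LEAST k. 1 - R k (xs ! 0) (xs ! 1) (xs ! 2) = 0)" for xs
  \<comment> \<open>The final \<open>- 1\<close> undoes the shift by one in the answers of an
    associate.\<close>
  define u where "u t ps = R (L (t # ps)) t (ps ! 0) (ps ! 1) - 1" for t ps
  have q: "\<exists>q. \<delta>' i q (\<Lambda> i (a n)) \<and>
      (\<forall>t. \<exists>k. R k t i n = Suc (q t) \<and> (\<forall>j<k. R j t i n = 0))" for i n
    using rep[of "[i]"] name[of n] unfolding fun_rep_def assoc_app_def R_def
    by (fastforce simp: map_replicate_const)
  have R: "recursive a (\<lambda>xs. R (f xs) (g xs) (h xs) (k xs))"
    if "recursive a f" "recursive a g" "recursive a h" "recursive a k" for a f g h k
    unfolding R_def by (intro recursive_app1[OF r] recursive_intros that)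
  have "recursive 3 L"
    unfolding L_def
  proof (rule recursive_Least)
    show "recursive (Suc 3) (\<lambda>ys. 1 - R (ys ! 0) (tl ys ! 0) (tl ys ! 1) (tl ys ! 2))"
      by (intro recursive_intros R; simp)
    fix xs :: "nat list"
    obtain k y where "R k (xs ! 0) (xs ! 1) (xs ! 2) = Suc y"
      using q by metis
    then show "\<exists>k. 1 - R k (xs ! 0) (xs ! 1) (xs ! 2) = 0"
      by (intro exI[of _ k]) simp
  qed
  then have "recursive 3 (\<lambda>ys. R (L ys) (ys ! 0) (ys ! 1) (ys ! 2) - 1)"
    by (intro recursive_intros R; simp)
  then have "recursive 3 (\<lambda>ys. u (ys ! 0) (tl ys))"
    by (rule recursive_cong) (auto simp: u_def length_Suc_conv eval_nat_numeral)
  moreover have "\<delta>' i (\<lambda>t. u t [i, n]) (\<Lambda> i (a n))" for i n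
  proof -
    obtain q where q': "\<delta>' i q (\<Lambda> i (a n))"
      "\<And>t. \<exists>k. R k t i n = Suc (q t) \<and> (\<forall>j<k. R j t i n = 0)"
      using q by blast
    have "u t [i, n] = q t" for t
    proof -
      obtain k where k: "R k t i n = Suc (q t)" "\<And>j. j < k \<Longrightarrow> R j t i n = 0"
        using q'(2) by blast
      have "L [t, i, n] = k"
        unfolding L_def
      proof (rule Least_equality)
        show "k \<le> j" if "1 - R j ([t, i, n] ! 0) ([t, i, n] ! 1) ([t, i, n] ! 2) = 0" for j
          using that k(2)[of j] by (cases "j < k") auto
      qed (simp add: k)
      then show ?thesis by (simp add: u_def k)
    qed
    then show ?thesis using q'(1) by presburger
  qed
  ultimately show thesis using that by blast
qed


section \<open>Hilbert spaces with explicit carriers\<close>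

context hilbert_space
begin

lemma scalars_simps [simp]:
  "carrier (scalars F) = F" "\<one>\<^bsub>scalars F\<^esub> = 1" "\<zero>\<^bsub>scalars F\<^esub> = 0"
  "x \<otimes>\<^bsub>scalars F\<^esub> y = x * y" "x \<oplus>\<^bsub>scalars F\<^esub> y = x + y"
  by (simp_all add: scalars_def)

lemma of_real_in_scalars [simp]: "of_real r \<in> F"
  using scalar_field by auto

lemma ip_add_right:
  "\<lbrakk>x \<in> carrier H; y \<in> carrier H; z \<in> carrier H\<rbrakk> \<Longrightarrow> ip H x (y \<oplus>\<^bsub>H\<^esub> z) = ip H x y + ip H x z"
  using ip_add_left[of y z x] ip_commute[of _ x] by (metis M.a_closed complex_cnj_add)

lemma ip_zero_left [simp]: "x \<in> carrier H \<Longrightarrow> ip H \<zero>\<^bsub>H\<^esub> x = 0"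
  using ip_add_left[of "\<zero>\<^bsub>H\<^esub>" "\<zero>\<^bsub>H\<^esub>" x] by simp

lemma ip_diff_left:
  assumes "x \<in> carrier H" "y \<in> carrier H" "z \<in> carrier H"
  shows "ip H (x \<ominus>\<^bsub>H\<^esub> y) z = ip H x z - ip H y z"
proof -
  have "ip H y z + ip H (\<ominus>\<^bsub>H\<^esub> y) z = 0"
    using ip_add_left[of y "\<ominus>\<^bsub>H\<^esub> y" z] assms by (simp add: M.r_neg)
  then show ?thesis
    using ip_add_left[of x "\<ominus>\<^bsub>H\<^esub> y" z] assms by (simp add: a_minus_def add_eq_0_iff)
qed

lemma ip_diff_right:
  "\<lbrakk>x \<in> carrier H; y \<in> carrier H; z \<in> carrier H\<rbrakk> \<Longrightarrow> ip H x (y \<ominus>\<^bsub>H\<^esub> z) = ip H x y - ip H x z"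
  using ip_diff_left[of y z x] ip_commute[of _ x] by (metis M.minus_closed complex_cnj_diff)

lemma ip_smult_right:
  "\<lbrakk>c \<in> F; x \<in> carrier H; y \<in> carrier H\<rbrakk> \<Longrightarrow> ip H x (c \<odot>\<^bsub>H\<^esub> y) = cnj c * ip H x y"
  using ip_smult_left[of c y x] ip_commute[of _ x] smult_closed[of c y]
  by (metis complex_cnj_mult scalars_simps(1))

lemma ip_self_nonneg: "x \<in> carrier H \<Longrightarrow> 0 \<le> Re (ip H x x)"
  using ip_pos by (cases "x = \<zero>\<^bsub>H\<^esub>") (auto intro: less_imp_le)

lemma hnorm_square: "x \<in> carrier H \<Longrightarrow> (hnorm H x)\<^sup>2 = Re (ip H x x)"
  unfolding hnorm_def using ip_self_nonneg by simp

lemma hnorm_nonneg [simp]: "x \<in> carrier H \<Longrightarrow> 0 \<le> hnorm H x"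
  unfolding hnorm_def using ip_self_nonneg by simp

lemma hnorm_zero [simp]: "hnorm H \<zero>\<^bsub>H\<^esub> = 0"
  unfolding hnorm_def by simp

lemma Re_ip_commute: "\<lbrakk>x \<in> carrier H; y \<in> carrier H\<rbrakk> \<Longrightarrow> Re (ip H x y) = Re (ip H y x)"
  using ip_commute[of x y] by simp

lemma hnorm_add_square:
  assumes "x \<in> carrier H" "y \<in> carrier H"
  shows "(hnorm H (x \<oplus>\<^bsub>H\<^esub> y))\<^sup>2 = (hnorm H x)\<^sup>2 + 2 * Re (ip H x y) + (hnorm H y)\<^sup>2"
  using assms Re_ip_commute[of x y] by (simp add: hnorm_square ip_add_left ip_add_right)

lemma hdist_square:
  assumes "x \<in> carrier H" "y \<in> carrier H"
  shows "(hdist H x y)\<^sup>2 = (hnorm H x)\<^sup>2 - 2 * Re (ip H x y) + (hnorm H y)\<^sup>2"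
  using assms Re_ip_commute[of x y]
  by (simp add: hdist_def hnorm_square ip_diff_left ip_diff_right)

lemma hnorm_smult:
  assumes c: "c \<in> F" and x: "x \<in> carrier H"
  shows "hnorm H (c \<odot>\<^bsub>H\<^esub> x) = cmod c * hnorm H x"
proof (rule power2_eq_imp_eq)
  have cx: "c \<odot>\<^bsub>H\<^esub> x \<in> carrier H"
    using assms by (simp add: smult_closed)
  have "ip H (c \<odot>\<^bsub>H\<^esub> x) (c \<odot>\<^bsub>H\<^esub> x) = (c * cnj c) * ip H x x"
    using ip_smult_left[OF c x cx] ip_smult_right[OF c x x] by simp
  also have "c * cnj c = of_real ((cmod c)\<^sup>2)"
    using complex_norm_square by simp
  finally show "(hnorm H (c \<odot>\<^bsub>H\<^esub> x))\<^sup>2 = (cmod c * hnorm H x)\<^sup>2"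
    using x cx by (simp add: power_mult_distrib hnorm_square del: of_real_power)
  show "0 \<le> hnorm H (c \<odot>\<^bsub>H\<^esub> x)"
    using cx by simp
qed (use x in simp)

section \<open>Cauchy-Schwarz and triangle inequalities\<close>

lemma hnorm_add_smult_square:
  assumes "x \<in> carrier H" "y \<in> carrier H"
  shows "(hnorm H (x \<oplus>\<^bsub>H\<^esub> complex_of_real t \<odot>\<^bsub>H\<^esub> y))\<^sup>2 =
    (hnorm H x)\<^sup>2 + 2 * t * Re (ip H x y) + t\<^sup>2 * (hnorm H y)\<^sup>2"
proof -
  have "complex_of_real t \<odot>\<^bsub>H\<^esub> y \<in> carrier H"
    using assms by (simp add: smult_closed)
  from hnorm_add_square[OF assms(1) this] show ?thesis
    using assms by (simp add: hnorm_smult ip_smult_right power_mult_distrib)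
qed

lemma Re_ip_le:
  assumes x: "x \<in> carrier H" and y: "y \<in> carrier H"
  shows "\<bar>Re (ip H x y)\<bar> \<le> hnorm H x * hnorm H y"
proof (cases "y = \<zero>\<^bsub>H\<^esub>")
  case True
  then show ?thesis using x Re_ip_commute[of x y] by simp
next
  case False
  define a N where "a = Re (ip H x y)" and "N = (hnorm H y)\<^sup>2"
  have N: "0 < N"
    using y ip_pos False by (simp add: N_def hnorm_square)
  \<comment> \<open>The squared norm of \<open>x + t y\<close> is a quadratic polynomial in
    \<open>t\<close>, and \<open>- a / N\<close> is its minimizer.\<close>
  have "0 \<le> (hnorm H x)\<^sup>2 + 2 * (- a / N) * a + (- a / N)\<^sup>2 * N"
    using hnorm_add_smult_square[OF x y, of "- a / N"] unfolding a_def N_def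
    by (metis zero_le_power2)
  also have "\<dots> = (hnorm H x)\<^sup>2 - a\<^sup>2 / N"
    using N by (simp add: field_simps power2_eq_square)
  finally have "a\<^sup>2 \<le> (hnorm H x)\<^sup>2 * N"
    using N by (simp add: field_simps)
  then have "\<bar>Re (ip H x y)\<bar>\<^sup>2 \<le> (hnorm H x * hnorm H y)\<^sup>2"
    by (simp add: a_def N_def power_mult_distrib)
  moreover have "0 \<le> hnorm H x * hnorm H y"
    using x y by simp
  ultimately show ?thesis
    by (rule power2_le_imp_le)
qed

lemma hnorm_triangle:
  assumes "x \<in> carrier H" "y \<in> carrier H"
  shows "hnorm H (x \<oplus>\<^bsub>H\<^esub> y) \<le> hnorm H x + hnorm H y"
proof (rule power2_le_imp_le)
  show "(hnorm H (x \<oplus>\<^bsub>H\<^esub> y))\<^sup>2 \<le> (hnorm H x + hnorm H y)\<^sup>2"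
    using Re_ip_le[OF assms] hnorm_add_square[OF assms] by (simp add: power2_sum)
qed (use assms in simp)

lemma hdist_nonneg [simp]: "\<lbrakk>x \<in> carrier H; y \<in> carrier H\<rbrakk> \<Longrightarrow> 0 \<le> hdist H x y"
  by (simp add: hdist_def)

lemma hdist_commute:
  assumes "x \<in> carrier H" "y \<in> carrier H"
  shows "hdist H x y = hdist H y x"
proof (rule power2_eq_imp_eq)
  show "(hdist H x y)\<^sup>2 = (hdist H y x)\<^sup>2"
    using assms Re_ip_commute[of x y] by (simp add: hdist_square)
qed (use assms in simp_all)

lemma hdist_self [simp]: "x \<in> carrier H \<Longrightarrow> hdist H x x = 0"
  by (simp add: hdist_def a_minus_def M.r_neg)

lemma hdist_zero_right [simp]: "x \<in> carrier H \<Longrightarrow> hdist H x \<zero>\<^bsub>H\<^esub> = hnorm H x"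
  using M.l_zero[OF M.a_inv_closed[OF M.zero_closed]] M.r_neg[OF M.zero_closed]
  by (simp add: hdist_def a_minus_def del: M.l_zero)

lemma hdist_triangle:
  assumes "x \<in> carrier H" "y \<in> carrier H" "z \<in> carrier H"
  shows "hdist H x z \<le> hdist H x y + hdist H y z"
proof -
  have "x \<ominus>\<^bsub>H\<^esub> z = (x \<ominus>\<^bsub>H\<^esub> y) \<oplus>\<^bsub>H\<^esub> (y \<ominus>\<^bsub>H\<^esub> z)"
    using assms by (simp add: a_minus_def M.a_ac M.r_neg2 M.r_neg1)
  then show ?thesis
    using hnorm_triangle[of "x \<ominus>\<^bsub>H\<^esub> y" "y \<ominus>\<^bsub>H\<^esub> z"] assms by (simp add: hdist_def)
qed

lemma hdist_le_add:
  "\<lbrakk>x \<in> carrier H; y \<in> carrier H; z \<in> carrier H\<rbrakk> \<Longrightarrow> \<bar>hdist H x y - hdist H x z\<bar> \<le> hdist H y z"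
  using hdist_triangle[of x y z] hdist_triangle[of x z y] hdist_commute[of y z] by simp

lemma hdist_add_le:
  assumes "x \<in> carrier H" "y \<in> carrier H" "x' \<in> carrier H" "y' \<in> carrier H"
  shows "hdist H (x \<oplus>\<^bsub>H\<^esub> y) (x' \<oplus>\<^bsub>H\<^esub> y') \<le> hdist H x x' + hdist H y y'"
proof -
  have "(x \<oplus>\<^bsub>H\<^esub> y) \<ominus>\<^bsub>H\<^esub> (x' \<oplus>\<^bsub>H\<^esub> y') = (x \<ominus>\<^bsub>H\<^esub> x') \<oplus>\<^bsub>H\<^esub> (y \<ominus>\<^bsub>H\<^esub> y')"
    using assms by (simp add: a_minus_def M.minus_add M.a_ac)
  then show ?thesis
    using hnorm_triangle[of "x \<ominus>\<^bsub>H\<^esub> x'" "y \<ominus>\<^bsub>H\<^esub> y'"] assms by (simp add: hdist_def)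
qed

lemma hdist_smult_left:
  assumes "a \<in> F" "b \<in> F" "x \<in> carrier H"
  shows "hdist H (a \<odot>\<^bsub>H\<^esub> x) (b \<odot>\<^bsub>H\<^esub> x) = cmod (a - b) * hnorm H x"
proof -
  have minus: "- b \<in> F"
    using assms(2) scalar_field by auto
  then have "\<ominus>\<^bsub>H\<^esub> (b \<odot>\<^bsub>H\<^esub> x) = (- b) \<odot>\<^bsub>H\<^esub> x"
    using assms smult_l_distr[of "- b" b x] smult_closed[of b x] smult_closed[of "- b" x]
      smult_l_null[of x]
    by (intro M.minus_equality) auto
  then have "a \<odot>\<^bsub>H\<^esub> x \<ominus>\<^bsub>H\<^esub> b \<odot>\<^bsub>H\<^esub> x = (a - b) \<odot>\<^bsub>H\<^esub> x"
    using assms minus smult_l_distr[of a "- b" x] by (simp add: a_minus_def)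
  moreover have "a - b \<in> F"
    using assms scalar_field by auto
  ultimately show ?thesis
    using assms(3) by (simp add: hdist_def hnorm_smult)
qed

section \<open>Riesz representation and adjoints\<close>

lemma ip_right_inject:
  assumes "y \<in> carrier H" "z \<in> carrier H" "\<And>x. x \<in> carrier H \<Longrightarrow> ip H x y = ip H x z"
  shows "y = z"
proof -
  have "Re (ip H (y \<ominus>\<^bsub>H\<^esub> z) (y \<ominus>\<^bsub>H\<^esub> z)) = 0"
    using assms ip_diff_right[of "y \<ominus>\<^bsub>H\<^esub> z" y z] by simp
  then have "y \<ominus>\<^bsub>H\<^esub> z = \<zero>\<^bsub>H\<^esub>"
    using ip_pos[of "y \<ominus>\<^bsub>H\<^esub> z"] assms by fastforce
  moreover have "(y \<ominus>\<^bsub>H\<^esub> z) \<oplus>\<^bsub>H\<^esub> z = y"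
    using assms by (simp add: a_minus_def M.a_assoc M.l_neg)
  ultimately show ?thesis using assms by simp
qed

text \<open>
  The representing vector is the limit of a minimizing sequence of \<open>\<parallel>x\<parallel>\<^sup>2 - 2 Re \<phi>(x)\<close>, which is
  Cauchy by the parallelogram law.
\<close>

lemma riesz_representation:
  assumes add: "\<And>x y. \<lbrakk>x \<in> carrier H; y \<in> carrier H\<rbrakk> \<Longrightarrow> \<phi> (x \<oplus>\<^bsub>H\<^esub> y) = \<phi> x + \<phi> y"
    and smult: "\<And>c x. \<lbrakk>c \<in> F; x \<in> carrier H\<rbrakk> \<Longrightarrow> \<phi> (c \<odot>\<^bsub>H\<^esub> x) = c * \<phi> x"
    and closed: "\<And>x. x \<in> carrier H \<Longrightarrow> \<phi> x \<in> F"
    and bounded: "\<And>x. x \<in> carrier H \<Longrightarrow> Re (\<phi> x) \<le> C * hnorm H x"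
  obtains z where "z \<in> carrier H" "\<And>x. x \<in> carrier H \<Longrightarrow> \<phi> x = ip H x z"
proof -
  define J where "J x = (hnorm H x)\<^sup>2 - 2 * Re (\<phi> x)" for x
  define m where "m = Inf (J ` carrier H)"
  \<comment> \<open>Completing the square: with h the norm of \<open>x\<close>, \<open>J x\<close>
    is at least h^2 - 2 C h = (h - C)^2 - C^2.\<close>
  have "- C\<^sup>2 \<le> J x" if "x \<in> carrier H" for x
  proof -
    have "0 \<le> (hnorm H x - C)\<^sup>2" by simp
    then show ?thesis
      using bounded[OF that] unfolding J_def power2_diff by (simp add: algebra_simps)
  qed
  then have bdd: "bdd_below (J ` carrier H)"
    by (rule bdd_belowI2)
  then have m_le: "m \<le> J x" if "x \<in> carrier H" for x
    unfolding m_def using that by (intro cInf_lower) auto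
  have "\<exists>x\<in>carrier H. J x < m + 1 / real (Suc n)" for n
    using cInf_less_iff[OF _ bdd, of "m + 1 / real (Suc n)"] M.zero_closed unfolding m_def by auto
  then obtain s where s: "s n \<in> carrier H" "J (s n) < m + 1 / real (Suc n)" for n
    by metis
  have half: "complex_of_real r \<odot>\<^bsub>H\<^esub> x \<in> carrier H" if "x \<in> carrier H" for r x
    using that by (simp add: smult_closed)
  \<comment> \<open>The midpoint \<open>?w\<close> satisfies \<open>m \<le> J ?w\<close>, while
    \<open>J\<close> at both ends is close to \<open>m\<close>. In the parallelogram identity the
    multiples of \<open>m\<close> cancel, and only the two errors remain.\<close>
  have cauchy: "(hdist H (s p) (s q))\<^sup>2 \<le> 2 / real (Suc p) + 2 / real (Suc q)" for p q
  proof -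
    let ?x = "s p" and ?y = "s q"
    let ?w = "complex_of_real (1/2) \<odot>\<^bsub>H\<^esub> (?x \<oplus>\<^bsub>H\<^esub> ?y)"
    have "hnorm H ?w = hnorm H (?x \<oplus>\<^bsub>H\<^esub> ?y) / 2"
      using hnorm_smult[OF of_real_in_scalars[of "1/2"], of "?x \<oplus>\<^bsub>H\<^esub> ?y"] s(1) by simp
    then have "(hnorm H ?w)\<^sup>2 = ((hnorm H ?x)\<^sup>2 + 2 * Re (ip H ?x ?y) + (hnorm H ?y)\<^sup>2) / 4"
      using hnorm_add_square[of ?x ?y] s(1) by (simp only: power_divide) simp
    moreover have "Re (\<phi> ?w) = (Re (\<phi> ?x) + Re (\<phi> ?y)) / 2"
      by (subst smult[OF of_real_in_scalars]) (use add[of ?x ?y] s(1) in simp_all)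
    ultimately have "(hdist H ?x ?y)\<^sup>2 = 2 * J ?x + 2 * J ?y - 4 * J ?w"
      using hdist_square[of ?x ?y] s(1) unfolding J_def by (simp add: field_simps)
    also have "\<dots> \<le> 2 / real (Suc p) + 2 / real (Suc q)"
      using s(2)[of p] s(2)[of q] m_le[of ?w] half[of "?x \<oplus>\<^bsub>H\<^esub> ?y" "1/2"] s(1) by simp
    finally show ?thesis .
  qed
  have "\<exists>N. \<forall>p\<ge>N. \<forall>q\<ge>N. hdist H (s p) (s q) < \<epsilon>" if "0 < \<epsilon>" for \<epsilon>
  proof -
    \<comment> \<open>From index \<open>N\<close> on, the two error terms together are at most 4 /
      (N + 1).\<close>
    have "0 < \<epsilon>\<^sup>2 / 4" using that by simp
    then obtain N where N: "inverse (real (Suc N)) < \<epsilon>\<^sup>2 / 4"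
      using reals_Archimedean by blast
    have "hdist H (s p) (s q) < \<epsilon>" if "N \<le> p" "N \<le> q" for p q
    proof (rule power2_less_imp_less)
      have "2 / real (Suc p) \<le> 2 / real (Suc N)" "2 / real (Suc q) \<le> 2 / real (Suc N)"
        using that by (auto intro!: divide_left_mono)
      then show "(hdist H (s p) (s q))\<^sup>2 < \<epsilon>\<^sup>2"
        using cauchy[of p q] N by (simp add: inverse_eq_divide)
    qed (use \<open>0 < \<epsilon>\<close> in simp)
    then show ?thesis by blast
  qed
  with complete[of s] s(1) obtain z where z: "z \<in> carrier H" "(\<lambda>n. hdist H (s n) z) \<longlonglongrightarrow> 0"
    by blast
  have Re_eq: "Re (\<phi> x) = Re (ip H x z)" if x: "x \<in> carrier H" for x
  proof -
    have "(\<lambda>n. Re (ip H x (s n)) - Re (ip H x z)) \<longlonglongrightarrow> 0"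
    proof (rule tendsto_0_le[OF z(2)])
      show "\<forall>\<^sub>F n in sequentially. norm (Re (ip H x (s n)) - Re (ip H x z)) \<le> norm (hdist H (s n) z) * hnorm H x"
        using Re_ip_le[OF x, of "s n \<ominus>\<^bsub>H\<^esub> z" for n] x s(1) z(1) ip_diff_right[of x "s n" z for n]
        by (auto simp: hdist_def mult.commute)
    qed
    then have lim: "(\<lambda>n. Re (ip H x (s n))) \<longlonglongrightarrow> Re (ip H x z)"
      by (rule LIM_zero_cancel)
    \<comment> \<open>Moving from \<open>s n\<close> by \<open>t x\<close> cannot bring
      \<open>J\<close> below \<open>m\<close>, and \<open>J (s n)\<close> exceeds \<open>m\<close>
      by less than 1 / (n + 1); the variational inequality at \<open>z\<close> is the limit.\<close>
    have ge: "0 \<le> 2 * t * (Re (ip H x z) - Re (\<phi> x)) + t\<^sup>2 * (hnorm H x)\<^sup>2" for t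
    proof (rule LIMSEQ_le)
      show "(\<lambda>n. 2 * t * (Re (ip H x (s n)) - Re (\<phi> x)) + t\<^sup>2 * (hnorm H x)\<^sup>2) \<longlonglongrightarrow>
          2 * t * (Re (ip H x z) - Re (\<phi> x)) + t\<^sup>2 * (hnorm H x)\<^sup>2"
        by (intro tendsto_intros lim)
      show "(\<lambda>n. - inverse (real (Suc n))) \<longlonglongrightarrow> 0"
        using tendsto_minus[OF LIMSEQ_inverse_real_of_nat] by simp
      have "- inverse (real (Suc n)) \<le> 2 * t * (Re (ip H x (s n)) - Re (\<phi> x)) + t\<^sup>2 * (hnorm H x)\<^sup>2" for n
      proof -
        let ?v = "complex_of_real t \<odot>\<^bsub>H\<^esub> x"
        have "Re (\<phi> (s n \<oplus>\<^bsub>H\<^esub> ?v)) = Re (\<phi> (s n)) + t * Re (\<phi> x)"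
          using add[OF s(1) half[OF x]] smult[OF of_real_in_scalars x] by simp
        then have "J (s n \<oplus>\<^bsub>H\<^esub> ?v) = J (s n) + 2 * t * (Re (ip H x (s n)) - Re (\<phi> x)) + t\<^sup>2 * (hnorm H x)\<^sup>2"
          using hnorm_add_smult_square[OF s(1) x, of n t] Re_ip_commute[OF x s(1), of n]
          unfolding J_def by (simp add: algebra_simps)
        moreover have "m \<le> J (s n \<oplus>\<^bsub>H\<^esub> ?v)"
          using m_le half[OF x] s(1) by simp
        ultimately show ?thesis
          using s(2)[of n] by (simp add: inverse_eq_divide)
      qed
      then show "\<exists>N. \<forall>n\<ge>N. - inverse (real (Suc n)) \<le>
          2 * t * (Re (ip H x (s n)) - Re (\<phi> x)) + t\<^sup>2 * (hnorm H x)\<^sup>2"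
        by blast
    qed
    define a where "a = Re (ip H x z) - Re (\<phi> x)"
    define b where "b = (hnorm H x)\<^sup>2"
    have "0 \<le> b" by (simp add: b_def)
    \<comment> \<open>This \<open>t\<close> is close to the minimizer \<open>- a / b\<close>, with
      \<open>b + 1\<close> in the denominator to cover \<open>b = 0\<close>. The right-hand side is
      then at most \<open>- (a\<^sup>2 / (b + 1))\<close>, which forces
      \<open>a = 0\<close>.\<close>
    have "0 \<le> 2 * (- a / (b + 1)) * a + (- a / (b + 1))\<^sup>2 * b"
      using ge[of "- a / (b + 1)"] by (simp add: a_def b_def)
    also have "(- a / (b + 1))\<^sup>2 * b \<le> (- a / (b + 1))\<^sup>2 * (b + 1)"
      by (intro mult_left_mono) auto
    also have "\<dots> = a\<^sup>2 / (b + 1)"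
      using \<open>0 \<le> b\<close> by (simp add: power2_eq_square)
    finally have "a\<^sup>2 / (b + 1) \<le> 0"
      by (simp add: power2_eq_square)
    then have "a = 0"
      using \<open>0 \<le> b\<close> by (simp add: divide_le_0_iff)
    then show ?thesis by (simp add: a_def)
  qed
  have "\<phi> x = ip H x z" if x: "x \<in> carrier H" for x
  proof (cases "F = \<real>")
    case True
    then show ?thesis
      using Re_eq[OF x] closed[OF x] ip_closed[OF x z(1)] by (auto simp: complex_eq_iff complex_is_Real_iff)
  next
    case False
    then have F: "\<i> \<in> F" using scalar_field by auto
    then have "\<i> \<odot>\<^bsub>H\<^esub> x \<in> carrier H" using x by (simp add: smult_closed)
    \<comment> \<open>Since Re (i w) = - Im w, equality of real parts at the multiple of
      \<open>x\<close> by \<open>\<i>\<close> gives equality of imaginary parts at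
      \<open>x\<close>.\<close>
    from Re_eq[OF this] have "Re (\<i> * \<phi> x) = Re (\<i> * ip H x z)"
      using F x z(1) by (simp add: smult ip_smult_left)
    then show ?thesis
      using Re_eq[OF x] by (simp add: complex_eq_iff)
  qed
  with z(1) that show thesis by blast
qed

end

text \<open>Riesz representation of \<open>\<lambda>x. ip K (T x) y\<close>, which is bounded by
  Cauchy-Schwarz in \<open>K\<close>. Nondegeneracy of the inner product makes the vector unique, so
  the description in \<open>adjoint\<close> denotes it.\<close>

lemma adjoint_ip:
  assumes "hilbert_space F H" "hilbert_space F K" "bounded_operator F H K T" "y \<in> carrier K"
  shows "adjoint H K T y \<in> carrier H"
    and "x \<in> carrier H \<Longrightarrow> ip H x (adjoint H K T y) = ip K (T x) y"
proof -
  interpret H: hilbert_space F H by fact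
  interpret K: hilbert_space F K by fact
  have T: "T x \<in> carrier K" if "x \<in> carrier H" for x
    using assms(3) that unfolding bounded_operator_def by auto
  obtain C where C: "hnorm K (T x) \<le> C * hnorm H x" if "x \<in> carrier H" for x
    using assms(3) unfolding bounded_operator_def by blast
  obtain z where z: "z \<in> carrier H" "\<And>x. x \<in> carrier H \<Longrightarrow> ip K (T x) y = ip H x z"
  proof (rule H.riesz_representation[of "\<lambda>x. ip K (T x) y" "C * hnorm K y"])
    fix x assume x: "x \<in> carrier H"
    have "Re (ip K (T x) y) \<le> hnorm K (T x) * hnorm K y"
      using K.Re_ip_le[OF T[OF x] assms(4)] by simp
    also have "\<dots> \<le> C * hnorm H x * hnorm K y"
      using C[OF x] assms(4) by (intro mult_right_mono) auto
    finally show "Re (ip K (T x) y) \<le> C * hnorm K y * hnorm H x"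
      by (simp add: mult_ac)
  qed (use assms(3,4) T K.ip_add_left K.ip_smult_left K.ip_closed in \<open>auto simp: bounded_operator_def\<close>)
  have "adjoint H K T y = z"
    unfolding adjoint_def
  proof (rule the_equality)
    fix w assume "w \<in> carrier H \<and> (\<forall>x\<in>carrier H. ip K (T x) y = ip H x w)"
    then show "w = z"
      using z by (intro H.ip_right_inject) auto
  qed (use z in auto)
  with z show "adjoint H K T y \<in> carrier H"
    "x \<in> carrier H \<Longrightarrow> ip H x (adjoint H K T y) = ip K (T x) y" by auto
qed

lemma hdist_adjoint_square:
  assumes "hilbert_space F H" "hilbert_space F K" "bounded_operator F H K T"
    and x: "x \<in> carrier H" and y: "y \<in> carrier K"
  shows "(hdist H x (adjoint H K T y))\<^sup>2 =
    (hnorm H x)\<^sup>2 + (hnorm H (adjoint H K T y))\<^sup>2 + (hdist K (T x) y)\<^sup>2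
      - (hnorm K (T x))\<^sup>2 - (hnorm K y)\<^sup>2"
proof -
  interpret H: hilbert_space F H by fact
  interpret K: hilbert_space F K by fact
  have "T x \<in> carrier K"
    using assms(3) x unfolding bounded_operator_def by auto
  then show ?thesis
    using adjoint_ip[OF assms(1-3) y] x y by (simp add: H.hdist_square K.hdist_square)
qed


section \<open>Density of the rational combinations\<close>

text \<open>Let l tend to infinity in the triangle inequality through \<open>\<alpha> (p l)\<close>;
  in the limit the strict bound becomes a weak one.\<close>

lemma cauchy_rep_dist:
  assumes "range \<alpha> \<subseteq> X" and "cauchy_rep X d \<alpha> p x"
    and triangle: "\<And>x y z. \<lbrakk>x \<in> X; y \<in> X; z \<in> X\<rbrakk> \<Longrightarrow> d x z \<le> d x y + d y z"
  shows "d (\<alpha> (p k)) x \<le> (1 / 2) ^ k"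
proof (rule LIMSEQ_le_const)
  have x: "x \<in> X" and lim: "(\<lambda>k. d (\<alpha> (p k)) x) \<longlonglongrightarrow> 0"
    and rapid: "\<And>k l. k < l \<Longrightarrow> d (\<alpha> (p k)) (\<alpha> (p l)) < (1 / 2) ^ k"
    using assms(2) unfolding cauchy_rep_def by auto
  show "(\<lambda>l. (1 / 2) ^ k + d (\<alpha> (p l)) x) \<longlonglongrightarrow> (1 / 2) ^ k"
    using tendsto_add[OF tendsto_const[of "(1 / 2) ^ k"] lim] by simp
  have "d (\<alpha> (p k)) x \<le> (1 / 2) ^ k + d (\<alpha> (p l)) x" if "k < l" for l
    using triangle[of "\<alpha> (p k)" "\<alpha> (p l)" x] assms(1) x rapid[OF that] by fastforce
  then show "\<exists>N. \<forall>l\<ge>N. d (\<alpha> (p k)) x \<le> (1 / 2) ^ k + d (\<alpha> (p l)) x"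
    by (meson Suc_le_eq)
qed

lemma rat_enum_eq_rat: "\<exists>n. rat_enum n = of_rat r"
proof -
  obtain p q where r: "r = Fract p q" "q > 0"
    by (cases r) auto
  \<comment> \<open>The numerator is split into positive and negative part; denominators are coded
    with an offset of one, hence \<open>nat q - 1\<close>.\<close>
  define n where "n = prod_encode (nat p, prod_encode (nat (- p), nat q - 1))"
  have "real (nat q - 1) + 1 = of_int q" "real (nat p) - real (nat (- p)) = of_int p"
    using r(2) by (auto simp: of_nat_diff)
  then have "rat_enum n = of_int p / of_int q"
    by (simp add: rat_enum_def n_def)
  then show ?thesis
    using r by (auto simp: of_rat_rat)
qed

lemma rat_enum_dense: "0 < \<epsilon> \<Longrightarrow> \<exists>n. \<bar>rat_enum n - x\<bar> < \<epsilon>"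
proof -
  assume "0 < \<epsilon>"
  then obtain r where r: "x < of_rat r" "of_rat r < x + \<epsilon>"
    using of_rat_dense[of x "x + \<epsilon>"] by auto
  obtain n where "rat_enum n = of_rat r"
    using rat_enum_eq_rat by blast
  with r have "\<bar>rat_enum n - x\<bar> < \<epsilon>" by simp
  then show ?thesis by blast
qed

context hilbert_space
begin

lemma scalar_enum_closed [simp]: "scalar_enum F n \<in> F"
  using scalar_field by (auto simp: scalar_enum_def split: prod.split)

lemma scalar_enum_dense:
  assumes "c \<in> F" "0 < \<epsilon>"
  shows "\<exists>n. cmod (scalar_enum F n - c) < \<epsilon>"
proof (cases "F = \<real>")
  case True
  then obtain x where "c = of_real x" using assms(1) by (auto elim: Reals_cases)
  with rat_enum_dense[OF assms(2), of x] show ?thesis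
    using True by (metis norm_of_real of_real_diff scalar_enum_def)
next
  case False
  obtain a where a: "\<bar>rat_enum a - Re c\<bar> < \<epsilon> / 2"
    using rat_enum_dense[of "\<epsilon> / 2" "Re c"] assms(2) by auto
  obtain b where b: "\<bar>rat_enum b - Im c\<bar> < \<epsilon> / 2"
    using rat_enum_dense[of "\<epsilon> / 2" "Im c"] assms(2) by auto
  have "cmod (scalar_enum F (prod_encode (a, b)) - c) < \<epsilon>"
    using a b cmod_le[of "scalar_enum F (prod_encode (a, b)) - c"] False
    by (simp add: scalar_enum_def)
  then show ?thesis by blast
qed

lemma lin_comb_closed:
  "\<lbrakk>range e \<subseteq> carrier H; set cs \<subseteq> F\<rbrakk> \<Longrightarrow> lin_comb H e cs \<in> carrier H"
  unfolding lin_comb_def by (intro M.finsum_closed) (auto intro!: smult_closed dest: nth_mem)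

lemma lin_comb_snoc:
  assumes "range e \<subseteq> carrier H" "set cs \<subseteq> F" "c \<in> F"
  shows "lin_comb H e (cs @ [c]) = c \<odot>\<^bsub>H\<^esub> e (length cs) \<oplus>\<^bsub>H\<^esub> lin_comb H e cs"
proof -
  have *: "(cs @ [c]) ! i \<odot>\<^bsub>H\<^esub> e i \<in> carrier H" if "i \<le> length cs" for i
    using that assms by (auto intro!: smult_closed simp: nth_append dest: nth_mem)
  have "lin_comb H e (cs @ [c]) =
      (\<Oplus>\<^bsub>H\<^esub>i\<in>insert (length cs) {..<length cs}. (cs @ [c]) ! i \<odot>\<^bsub>H\<^esub> e i)"
    by (simp add: lin_comb_def lessThan_Suc)
  also have "\<dots> = (cs @ [c]) ! length cs \<odot>\<^bsub>H\<^esub> e (length cs) \<oplus>\<^bsub>H\<^esub>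
      (\<Oplus>\<^bsub>H\<^esub>i\<in>{..<length cs}. (cs @ [c]) ! i \<odot>\<^bsub>H\<^esub> e i)"
    by (rule M.finsum_insert) (use * *[of "length cs"] in auto)
  also have "(\<Oplus>\<^bsub>H\<^esub>i\<in>{..<length cs}. (cs @ [c]) ! i \<odot>\<^bsub>H\<^esub> e i) = lin_comb H e cs"
    unfolding lin_comb_def using assms
    by (intro M.finsum_cong') (auto simp: nth_append intro!: smult_closed dest: nth_mem)
  finally show ?thesis by simp
qed

lemma comb_enum_closed: "range e \<subseteq> carrier H \<Longrightarrow> comb_enum F H e n \<in> carrier H"
  unfolding comb_enum_def by (intro lin_comb_closed) auto

text \<open>Code 0 is the empty coefficient list. Norms are therefore distances to the element with
  code 0 and inherit computability from the metric.\<close>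

lemma comb_enum_0: "comb_enum F H e 0 = \<zero>\<^bsub>H\<^esub>"
  by (simp add: comb_enum_def lin_comb_def)

text \<open>Coefficients are replaced one by one. Keeping \<open>length ns = length cs\<close> in
  the induction ensures that an appended coefficient meets the same basis vector in both
  combinations.\<close>

lemma comb_enum_dense_lin_comb:
  assumes e: "range e \<subseteq> carrier H" and "set cs \<subseteq> F" "0 < \<epsilon>"
  shows "\<exists>ns. hdist H (lin_comb H e (map (scalar_enum F) ns)) (lin_comb H e cs) < \<epsilon> \<and> length ns = length cs"
  using assms(2,3)
proof (induction cs arbitrary: \<epsilon> rule: rev_induct)
  case Nil
  then show ?case by (intro exI[of _ "[]"]) (simp add: lin_comb_def)
next
  case (snoc c cs)
  then obtain ns where ns: "hdist H (lin_comb H e (map (scalar_enum F) ns)) (lin_comb H e cs) < \<epsilon> / 2"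
      "length ns = length cs"
    using snoc.IH[of "\<epsilon> / 2"] by auto
  let ?x = "e (length cs)"
  have x: "?x \<in> carrier H" using e by auto
  \<comment> \<open>Adding 1 keeps the denominator positive when \<open>?x\<close> is zero.\<close>
  have "0 < \<epsilon> / 2 / (hnorm H ?x + 1)"
    using x snoc.prems(2) hnorm_nonneg[OF x] by (intro divide_pos_pos) linarith+
  then obtain n where n: "cmod (scalar_enum F n - c) < \<epsilon> / 2 / (hnorm H ?x + 1)"
    using scalar_enum_dense[of c] snoc.prems(1) by auto
  have closed: "lin_comb H e cs \<in> carrier H" "lin_comb H e (map (scalar_enum F) ns) \<in> carrier H"
    using e snoc.prems(1) by (auto intro!: lin_comb_closed)
  have "hdist H (lin_comb H e (map (scalar_enum F) (ns @ [n]))) (lin_comb H e (cs @ [c])) \<le>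
      hdist H (scalar_enum F n \<odot>\<^bsub>H\<^esub> ?x) (c \<odot>\<^bsub>H\<^esub> ?x)
        + hdist H (lin_comb H e (map (scalar_enum F) ns)) (lin_comb H e cs)"
    using hdist_add_le[of "scalar_enum F n \<odot>\<^bsub>H\<^esub> ?x" "lin_comb H e (map (scalar_enum F) ns)"
        "c \<odot>\<^bsub>H\<^esub> ?x" "lin_comb H e cs"] closed x snoc.prems(1)
      lin_comb_snoc[OF e, of cs c] lin_comb_snoc[OF e, of "map (scalar_enum F) ns" "scalar_enum F n"] ns(2)
    by (simp add: smult_closed image_subset_iff)
  also have "\<dots> < cmod (scalar_enum F n - c) * hnorm H ?x + \<epsilon> / 2"
    using ns(1) snoc.prems(1) x by (simp add: hdist_smult_left)
  also have "cmod (scalar_enum F n - c) * hnorm H ?x \<le> cmod (scalar_enum F n - c) * (hnorm H ?x + 1)"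
    by (intro mult_left_mono) auto
  also have "\<dots> \<le> \<epsilon> / 2"
    using n hnorm_nonneg[OF x] by (simp add: field_simps)
  finally show ?case
    using ns(2) by (intro exI[of _ "ns @ [n]"]) simp
qed

lemma comb_enum_dense:
  assumes "fundamental_sequence F H e" "x \<in> carrier H" "0 < \<epsilon>"
  shows "\<exists>n. hdist H (comb_enum F H e n) x < \<epsilon>"
proof -
  have e: "range e \<subseteq> carrier H" using assms(1) unfolding fundamental_sequence_def by blast
  obtain cs where cs: "set cs \<subseteq> F" "hdist H (lin_comb H e cs) x < \<epsilon> / 2"
    using assms unfolding fundamental_sequence_def by (meson half_gt_zero)
  then obtain ns where "hdist H (lin_comb H e (map (scalar_enum F) ns)) (lin_comb H e cs) < \<epsilon> / 2"
    using comb_enum_dense_lin_comb[OF e cs(1), of "\<epsilon> / 2"] assms(3) by auto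
  then have ns: "hdist H (comb_enum F H e (list_encode ns)) (lin_comb H e cs) < \<epsilon> / 2"
    by (simp add: comb_enum_def)
  have "hdist H (comb_enum F H e (list_encode ns)) x < \<epsilon>"
    using hdist_triangle[of "comb_enum F H e (list_encode ns)" "lin_comb H e cs" x] ns cs
      comb_enum_closed[OF e] lin_comb_closed[OF e cs(1)] assms(2) by auto
  then show ?thesis by blast
qed

section \<open>Names of vectors and the precision they give\<close>

lemma hilbert_rep_const:
  "range e \<subseteq> carrier H \<Longrightarrow> hilbert_rep F H e (\<lambda>_. n) (comb_enum F H e n)"
  by (simp add: hilbert_rep_def cauchy_rep_def comb_enum_closed)

lemma hilbert_rep_dist:
  assumes "range e \<subseteq> carrier H" "hilbert_rep F H e p x"
  shows "hdist H (comb_enum F H e (p k)) x \<le> (1 / 2) ^ k"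
  using assms unfolding hilbert_rep_def
  by (intro cauchy_rep_dist[of _ "carrier H"]) (auto intro: hdist_triangle comb_enum_closed)

lemma hdist_approx:
  assumes e: "range e \<subseteq> carrier H" and p: "hilbert_rep F H e p x" and q: "hilbert_rep F H e q y"
  shows "\<bar>hdist H (comb_enum F H e (p k)) (comb_enum F H e (q k)) - hdist H x y\<bar> \<le> 2 * (1 / 2) ^ k"
proof -
  let ?a = "comb_enum F H e (p k)" and ?b = "comb_enum F H e (q k)"
  have closed: "x \<in> carrier H" "y \<in> carrier H" "?a \<in> carrier H" "?b \<in> carrier H"
    using p q comb_enum_closed[OF e] by (auto simp: hilbert_rep_def cauchy_rep_def)
  then have "\<bar>hdist H ?a ?b - hdist H x y\<bar> \<le> hdist H ?a x + hdist H ?b y"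
    using hdist_le_add[of ?a ?b y] hdist_le_add[of y ?a x] hdist_commute[of y] by simp
  then show ?thesis
    using hilbert_rep_dist[OF e p, of k] hilbert_rep_dist[OF e q, of k] by simp
qed

text \<open>The exponent \<open>Suc k\<close> leaves room for two errors: for \<open>k < l\<close>
  the distances of both approximations to \<open>x\<close> add up to less than 2^(-k), as a name
  requires.\<close>

lemma hilbert_repI:
  assumes e: "range e \<subseteq> carrier H" and x: "x \<in> carrier H"
    and p: "\<And>k. hdist H (comb_enum F H e (p k)) x < (1 / 2) ^ Suc k"
  shows "hilbert_rep F H e p x"
  unfolding hilbert_rep_def cauchy_rep_def
proof (intro conjI allI impI x)
  let ?a = "\<lambda>n. comb_enum F H e (p n)"
  fix k l :: nat assume "k < l"
  then have "(1 / 2 :: real) ^ Suc l \<le> (1 / 2) ^ Suc k"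
    by (intro power_decreasing) auto
  then have "(1 / 2 :: real) ^ Suc k + (1 / 2) ^ Suc l \<le> 2 * (1 / 2) ^ Suc k" by linarith
  also have "\<dots> = (1 / 2) ^ k" by simp
  finally have "(1 / 2 :: real) ^ Suc k + (1 / 2) ^ Suc l \<le> (1 / 2) ^ k" .
  then show "hdist H (?a k) (?a l) < (1 / 2) ^ k"
    using hdist_triangle[of "?a k" x "?a l"] hdist_commute[of x "?a l"]
      comb_enum_closed[OF e] x p[of k] p[of l] by simp
next
  have *: "norm (hdist H (comb_enum F H e (p k)) x) \<le> norm ((1 / 2 :: real) ^ Suc k) * 1" for k
    using p[of k] hdist_nonneg[OF comb_enum_closed[OF e] x] by (simp add: less_imp_le)
  have "(\<lambda>k. (1 / 2 :: real) ^ Suc k) \<longlonglongrightarrow> 0"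
    by (intro LIMSEQ_Suc LIMSEQ_power_zero) simp
  then show "(\<lambda>k. hdist H (comb_enum F H e (p k)) x) \<longlonglongrightarrow> 0"
    by (rule tendsto_0_le[where K = 1]) (intro always_eventually allI *)
qed

end


section \<open>Integer approximations of nonnegative reals\<close>

text \<open>With \<open>a - b\<close> truncated, this is the positive part of the rational with code
  \<open>q\<close>, scaled by 2^t and rounded down.\<close>

definition nat_approx :: "nat \<Rightarrow> nat \<Rightarrow> nat" where
  "nat_approx q t = (case prod_decode q of (a, m) \<Rightarrow> case prod_decode m of (b, c) \<Rightarrow>
     (a - b) * 2 ^ t div Suc c)"

text \<open>One unit of error comes from the precision 2^(-t) of the name after scaling, the other
  from rounding down.\<close>

lemma nat_approx_real_rep:
  assumes "real_rep p x" "0 \<le> x"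
  shows "\<bar>real (nat_approx (p t) t) - 2 ^ t * x\<bar> \<le> 2"
proof -
  obtain a b c where abc: "p t = prod_encode (a, prod_encode (b, c))"
    by (metis prod_decode_inverse surj_pair)
  define y where "y = real (a - b) / real (Suc c)"
  have "dist (rat_enum (p t)) x \<le> (1 / 2) ^ t"
    using assms(1) unfolding real_rep_def by (intro cauchy_rep_dist[of _ UNIV]) (auto intro: dist_triangle)
  moreover have "rat_enum (p t) = (real a - real b) / real (Suc c)"
    by (simp add: rat_enum_def abc)
  \<comment> \<open>Replacing a negative rational by 0 only brings it closer to \<open>x\<close>, as
    \<open>x\<close> is nonnegative.\<close>
  moreover have "y = (real a - real b) / real (Suc c) \<or> (y = 0 \<and> (real a - real b) / real (Suc c) \<le> 0)"
    by (cases "b \<le> a") (auto simp: y_def of_nat_diff divide_nonpos_pos)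
  ultimately have "\<bar>y - x\<bar> \<le> (1 / 2) ^ t"
    using assms(2) by (auto simp: dist_real_def)
  then have "2 ^ t * \<bar>y - x\<bar> \<le> 2 ^ t * (1 / 2) ^ t"
    by (intro mult_left_mono) auto
  then have 1: "\<bar>2 ^ t * y - 2 ^ t * x\<bar> \<le> 1"
    by (simp add: abs_mult power_divide flip: right_diff_distrib)
  have "2 ^ t * y = real ((a - b) * 2 ^ t) / real (Suc c)"
    by (simp add: y_def)
  moreover have "nat_approx (p t) t = (a - b) * 2 ^ t div Suc c"
    by (simp add: nat_approx_def abc)
  ultimately have "\<bar>real (nat_approx (p t) t) - 2 ^ t * y\<bar> \<le> 1"
    using floor_correct[of "real ((a - b) * 2 ^ t) / real (Suc c)"]
    unfolding floor_divide_of_nat_eq by (simp only: of_int_of_nat_eq) linarith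
  with 1 show ?thesis by simp
qed

lemma recursive_nat_approx:
  "recursive a f \<Longrightarrow> recursive a g \<Longrightarrow> recursive a (\<lambda>xs. nat_approx (f xs) (g xs))"
  unfolding nat_approx_def case_prod_beta by (intro recursive_intros; simp)

text \<open>Moves the search from names of reals to integers, whose comparison is decidable.\<close>

lemma recursive_approx:
  assumes "computable_map \<delta> (\<lambda>_. real_rep) f" "recursive (Suc b) (\<lambda>ys. r (ys ! 0) (tl ys))"
    and "\<And>ps. length ps = b \<Longrightarrow> \<delta> (\<lambda>m. r m ps) (x ps)" "\<And>z. 0 \<le> f z"
  obtains s where "recursive (Suc b) (\<lambda>ys. s (ys ! 0) (tl ys))"
    and "\<And>t ps. length ps = b \<Longrightarrow> \<bar>real (s t ps) - 2 ^ t * f (x ps)\<bar> \<le> 2"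
proof -
  obtain s where s: "recursive (Suc b) (\<lambda>ys. s (ys ! 0) (tl ys))"
    and rep: "\<And>ps. length ps = b \<Longrightarrow> real_rep (\<lambda>m. s m ps) (f (x ps))"
    using recursive_computable_map[OF assms(1-3)] by blast
  have "recursive (Suc b) (\<lambda>ys. nat_approx (s (ys ! 0) (tl ys)) (ys ! 0))"
    by (intro recursive_nat_approx s recursive_nth) simp
  moreover have "\<bar>real (nat_approx (s t ps) t) - 2 ^ t * f (x ps)\<bar> \<le> 2" if "length ps = b" for t ps
    using nat_approx_real_rep[OF rep[OF that] assms(4), of t] .
  ultimately show thesis using that[of "\<lambda>t ps. nat_approx (s t ps) t"] by blast
qed

text \<open>\<open>n + 4\<close> lies between \<open>w * a\<close> and \<open>w * a + 8\<close>. The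
  first bound serves soundness of the square test, the second its completeness.\<close>

lemma approx_square_upper:
  fixes a w :: real
  assumes "\<bar>real n - w * a\<bar> \<le> 4" "0 \<le> w" "0 \<le> a"
  shows "w\<^sup>2 * a\<^sup>2 \<le> real ((n + 4) * (n + 4))"
    and "real ((n + 4) * (n + 4)) \<le> w\<^sup>2 * a\<^sup>2 + 16 * (w * a) + 64"
proof -
  have "(w * a)\<^sup>2 \<le> (real n + 4)\<^sup>2"
    using assms by (intro power_mono) auto
  then show "w\<^sup>2 * a\<^sup>2 \<le> real ((n + 4) * (n + 4))"
    by (simp add: power_mult_distrib power2_eq_square[of "real n + 4"])
  have "(real n + 4)\<^sup>2 \<le> (w * a + 8)\<^sup>2"
    using assms by (intro power_mono) auto
  then show "real ((n + 4) * (n + 4)) \<le> w\<^sup>2 * a\<^sup>2 + 16 * (w * a) + 64"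
    by (simp add: power_mult_distrib power2_eq_square[of "real n + 4"] power2_sum[of "w * a"])
qed

lemma approx_square_lower:
  fixes a w :: real
  assumes "\<bar>real n - w * a\<bar> \<le> 4" "0 \<le> w" "0 \<le> a"
  shows "real ((n - 4) * (n - 4)) \<le> w\<^sup>2 * a\<^sup>2"
    and "w\<^sup>2 * a\<^sup>2 - 16 * (w * a) \<le> real ((n - 4) * (n - 4))"
proof -
  have "0 \<le> w * a" using assms by simp
  \<comment> \<open>Truncation at 0 preserves both bounds on \<open>n - 4\<close>: the upper one
    because \<open>w * a\<close> is nonnegative, the lower one because truncation only increases the
    value.\<close>
  moreover have "real (n - 4) = real n - 4 \<or> real (n - 4) = 0 \<and> real n \<le> 4"
    by (cases "4 \<le> n") (auto simp: of_nat_diff)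
  ultimately have le: "real (n - 4) \<le> w * a" "w * a - 8 \<le> real (n - 4)"
    using assms(1) by auto
  then have "(real (n - 4))\<^sup>2 \<le> (w * a)\<^sup>2"
    by (intro power_mono) auto
  then show "real ((n - 4) * (n - 4)) \<le> w\<^sup>2 * a\<^sup>2"
    by (simp add: power_mult_distrib power2_eq_square[of "real (n - 4)"])
  have "(w * a)\<^sup>2 - 16 * (w * a) \<le> (real (n - 4))\<^sup>2"
  proof (cases "8 \<le> w * a")
    case True
    with le(2) have "(w * a - 8)\<^sup>2 \<le> (real (n - 4))\<^sup>2"
      by (intro power_mono) auto
    then show ?thesis by (simp add: power2_diff)
  next
    \<comment> \<open>Here \<open>w * a < 8\<close>, so the left-hand side is not positive.\<close>
    case False
    have "(w * a)\<^sup>2 \<le> 16 * (w * a)"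
      using False \<open>0 \<le> w * a\<close> by (simp add: power2_eq_square mult_right_mono)
    then show ?thesis
      using zero_le_power2[of "real (n - 4)"] by linarith
  qed
  then show "w\<^sup>2 * a\<^sup>2 - 16 * (w * a) \<le> real ((n - 4) * (n - 4))"
    by (simp add: power_mult_distrib power2_eq_square[of "real (n - 4)"])
qed

text \<open>
  The arguments \<open>A, \<dots>, D\<close> approximate reals \<open>a, \<dots>, d\<close> scaled by \<open>2^(s + k)\<close>, with error at most \<open>4\<close>;
  value \<open>0\<close> certifies \<open>a\<^sup>2 + b\<^sup>2 + e\<^sup>2 - c\<^sup>2 - d\<^sup>2 < 4^(-k)\<close>. After scaling, the right-hand side is \<open>4^s\<close>.
\<close>

definition square_test :: "nat \<Rightarrow> nat \<Rightarrow> nat \<Rightarrow> nat \<Rightarrow> nat \<Rightarrow> nat \<Rightarrow> nat" where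
  "square_test s A B E C D =
    Suc ((A + 4) * (A + 4) + (B + 4) * (B + 4) + (E + 4) * (E + 4))
      - ((C - 4) * (C - 4) + (D - 4) * (D - 4) + 4 ^ s)"

lemma power_4_eq: "real (4 ^ s) = (2 ^ (s + k))\<^sup>2 * ((1 / 2) ^ k)\<^sup>2"
proof -
  have "2 ^ (s + k) * (1 / 2) ^ k = (2 :: real) ^ s"
    by (simp add: power_add power_divide)
  then have "(2 ^ (s + k))\<^sup>2 * ((1 / 2) ^ k)\<^sup>2 = ((2 :: real) ^ s)\<^sup>2"
    by (metis power_mult_distrib)
  then show ?thesis
    by (simp add: power2_eq_square flip: power_mult_distrib)
qed

text \<open>Rounding is one-sided: the squares with positive sign are overestimated and those with
  negative sign underestimated, so a successful integer comparison implies the real one.\<close>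

lemma square_test_sound:
  fixes a b e c d :: real
  assumes nonneg: "0 \<le> a" "0 \<le> b" "0 \<le> e" "0 \<le> c" "0 \<le> d"
    and approx: "\<bar>real A - 2 ^ (s + k) * a\<bar> \<le> 4" "\<bar>real B - 2 ^ (s + k) * b\<bar> \<le> 4"
      "\<bar>real E - 2 ^ (s + k) * e\<bar> \<le> 4" "\<bar>real C - 2 ^ (s + k) * c\<bar> \<le> 4"
      "\<bar>real D - 2 ^ (s + k) * d\<bar> \<le> 4"
    and "square_test s A B E C D = 0"
  shows "a\<^sup>2 + b\<^sup>2 + e\<^sup>2 - c\<^sup>2 - d\<^sup>2 < ((1 / 2) ^ k)\<^sup>2"
proof -
  let ?w = "2 ^ (s + k) :: real"
  have "(A + 4) * (A + 4) + (B + 4) * (B + 4) + (E + 4) * (E + 4) <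
      (C - 4) * (C - 4) + (D - 4) * (D - 4) + 4 ^ s"
    using assms(11) unfolding square_test_def by linarith
  then have "real ((A + 4) * (A + 4)) + real ((B + 4) * (B + 4)) + real ((E + 4) * (E + 4)) <
      real ((C - 4) * (C - 4)) + real ((D - 4) * (D - 4)) + real (4 ^ s)"
    by (simp only: of_nat_add[symmetric] of_nat_less_iff)
  moreover have "real (4 ^ s) = ?w\<^sup>2 * ((1 / 2) ^ k)\<^sup>2"
    by (rule power_4_eq)
  ultimately have "?w\<^sup>2 * a\<^sup>2 + ?w\<^sup>2 * b\<^sup>2 + ?w\<^sup>2 * e\<^sup>2 < ?w\<^sup>2 * c\<^sup>2 + ?w\<^sup>2 * d\<^sup>2 + ?w\<^sup>2 * ((1 / 2) ^ k)\<^sup>2"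
    using approx_square_upper(1)[OF approx(1)] approx_square_upper(1)[OF approx(2)]
      approx_square_upper(1)[OF approx(3)] approx_square_lower(1)[OF approx(4)]
      approx_square_lower(1)[OF approx(5)] nonneg by simp
  then have "?w\<^sup>2 * (a\<^sup>2 + b\<^sup>2 + e\<^sup>2) < ?w\<^sup>2 * (c\<^sup>2 + d\<^sup>2 + ((1 / 2) ^ k)\<^sup>2)"
    by (simp only: distrib_left)
  then have "a\<^sup>2 + b\<^sup>2 + e\<^sup>2 < c\<^sup>2 + d\<^sup>2 + ((1 / 2) ^ k)\<^sup>2"
    by (rule mult_left_less_imp_less) simp
  then show ?thesis by simp
qed

text \<open>At scale w = 2^(s + k) the rounding errors grow linearly in w, whereas the strict gap
  \<open>\<Delta>\<close> is multiplied by w^2 and eventually dominates.\<close>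

lemma square_test_complete:
  fixes a b e c d :: real
  assumes nonneg: "0 \<le> a" "0 \<le> b" "0 \<le> e" "0 \<le> c" "0 \<le> d"
    and approx: "\<And>s. \<bar>real (A s) - 2 ^ (s + k) * a\<bar> \<le> 4" "\<And>s. \<bar>real (B s) - 2 ^ (s + k) * b\<bar> \<le> 4"
      "\<And>s. \<bar>real (E s) - 2 ^ (s + k) * e\<bar> \<le> 4" "\<And>s. \<bar>real (C s) - 2 ^ (s + k) * c\<bar> \<le> 4"
      "\<And>s. \<bar>real (D s) - 2 ^ (s + k) * d\<bar> \<le> 4"
    and less: "a\<^sup>2 + b\<^sup>2 + e\<^sup>2 - c\<^sup>2 - d\<^sup>2 < ((1 / 2) ^ k)\<^sup>2"
  shows "\<exists>s. square_test s (A s) (B s) (E s) (C s) (D s) = 0"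
proof -
  define \<Delta> S where "\<Delta> = c\<^sup>2 + d\<^sup>2 + ((1 / 2) ^ k)\<^sup>2 - (a\<^sup>2 + b\<^sup>2 + e\<^sup>2)" and "S = a + b + e + c + d"
  have "0 < \<Delta>" "0 \<le> S" using less nonneg by (auto simp: \<Delta>_def S_def)
  \<comment> \<open>The error is at most \<open>16 * S * w + 192\<close>: each of the five squares
    contributes 16 w times its root, and each of the three upper estimates a further 64.\<close>
  then obtain s where s: "(1 / 2) ^ s < \<Delta> / (16 * S + 192)"
    using real_arch_pow_inv[of "\<Delta> / (16 * S + 192)" "1 / 2"] by auto
  define w :: real where "w = 2 ^ (s + k)"
  have "1 \<le> w" "2 ^ s \<le> w" unfolding w_def by (auto intro: power_increasing)
  have "1 < \<Delta> / (16 * S + 192) * 2 ^ s"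
    using s by (simp add: power_divide divide_less_eq)
  then have "16 * S + 192 < \<Delta> * 2 ^ s"
    using \<open>0 \<le> S\<close> by (simp add: field_simps)
  also have "\<dots> \<le> \<Delta> * w"
    using \<open>0 < \<Delta>\<close> \<open>2 ^ s \<le> w\<close> by (intro mult_left_mono) auto
  finally have "w * (16 * S + 192) < w * (\<Delta> * w)"
    using \<open>1 \<le> w\<close> by (intro mult_strict_left_mono) auto
  moreover have "192 \<le> w * 192"
    using \<open>1 \<le> w\<close> by simp
  ultimately have "w * (16 * S) + 192 < w\<^sup>2 * \<Delta>"
    by (simp add: power2_eq_square algebra_simps)
  moreover have "real (4 ^ s) = w\<^sup>2 * ((1 / 2) ^ k)\<^sup>2"
    unfolding w_def by (rule power_4_eq)
  ultimately have "real ((A s + 4) * (A s + 4)) + real ((B s + 4) * (B s + 4)) + real ((E s + 4) * (E s + 4)) <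
      real ((C s - 4) * (C s - 4)) + real ((D s - 4) * (D s - 4)) + real (4 ^ s)"
    using approx_square_upper(2)[OF approx(1)[of s]] approx_square_upper(2)[OF approx(2)[of s]]
      approx_square_upper(2)[OF approx(3)[of s]] approx_square_lower(2)[OF approx(4)[of s]]
      approx_square_lower(2)[OF approx(5)[of s]] nonneg
    unfolding w_def[symmetric] \<Delta>_def S_def using \<open>1 \<le> w\<close> by (simp add: algebra_simps)
  then have "(A s + 4) * (A s + 4) + (B s + 4) * (B s + 4) + (E s + 4) * (E s + 4) <
      (C s - 4) * (C s - 4) + (D s - 4) * (D s - 4) + 4 ^ s"
    by (simp only: of_nat_add[symmetric] of_nat_less_iff)
  then show ?thesis
    unfolding square_test_def by (intro exI[of _ s]) linarith
qed


section \<open>The frame of adjoint images\<close>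

lemma frame_adjoint:
  assumes H: "hilbert_space F H" and K: "\<And>i. hilbert_space F (K i)"
    and "g_frame F H K \<Lambda>" and g: "\<And>i. frame_with_bounds (K i) (g i) (A i) (B i)"
    and A0: "0 < A0" "\<And>i. A0 \<le> A i" and B0: "\<And>i. B i \<le> B0"
  shows "\<exists>A B. frame_with_bounds H (\<lambda>(i, j). adjoint H (K i) (\<Lambda> i) (g i j)) A B"
proof -
  interpret H: hilbert_space F H by fact
  have op: "bounded_operator F H (K i) (\<Lambda> i)" for i
    using assms(3) unfolding g_frame_def by blast
  obtain C D where CD: "0 < C" "C \<le> D" and
    gf: "\<And>x. x \<in> carrier H \<Longrightarrow> (\<lambda>i. (hnorm (K i) (\<Lambda> i x))\<^sup>2) summable_on UNIV \<and>
         C * (hnorm H x)\<^sup>2 \<le> (\<Sum>\<^sub>\<infinity>i. (hnorm (K i) (\<Lambda> i x))\<^sup>2) \<and>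
         (\<Sum>\<^sub>\<infinity>i. (hnorm (K i) (\<Lambda> i x))\<^sup>2) \<le> D * (hnorm H x)\<^sup>2"
    using assms(3) unfolding g_frame_def by blast
  have AB: "0 < A i" "A i \<le> B i" and gc: "g i j \<in> carrier (K i)" for i j
    using g[of i] unfolding frame_with_bounds_def by auto
  have "A0 \<le> B0"
    using A0(2)[of 0] AB(2)[of 0] B0[of 0] by linarith
  have Lc: "\<Lambda> i x \<in> carrier (K i)" if "x \<in> carrier H" for i x
    using op[of i] that unfolding bounded_operator_def by auto
  show ?thesis
    unfolding frame_with_bounds_def
  proof (intro exI conjI ballI)
    \<comment> \<open>The frame bounds are products of the uniform bounds of the local frames with
      those of the g-frame.\<close>
    show "0 < A0 * C" using A0 CD by simp
    show "A0 * C \<le> B0 * D"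
      using A0(1) CD \<open>A0 \<le> B0\<close> by (intro mult_mono) auto
    show "range (\<lambda>(i, j). adjoint H (K i) (\<Lambda> i) (g i j)) \<subseteq> carrier H"
      using adjoint_ip(1)[OF H K op gc] by auto
  next
    fix x assume x: "x \<in> carrier H"
    define G where "G i = (\<Sum>\<^sub>\<infinity>j. (cmod (ip (K i) (\<Lambda> i x) (g i j)))\<^sup>2)" for i
    define f where "f = (\<lambda>k. (cmod (ip H x (case k of (i, j) \<Rightarrow> adjoint H (K i) (\<Lambda> i) (g i j))))\<^sup>2)"
    have f: "f (i, j) = (cmod (ip (K i) (\<Lambda> i x) (g i j)))\<^sup>2" for i j
      by (simp add: f_def adjoint_ip(2)[OF H K op gc x])
    let ?L = "\<lambda>i. (hnorm (K i) (\<Lambda> i x))\<^sup>2"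
    have G: "(\<lambda>j. (cmod (ip (K i) (\<Lambda> i x) (g i j)))\<^sup>2) summable_on UNIV"
      "A i * ?L i \<le> G i" "G i \<le> B i * ?L i" for i
      using g[of i] Lc[OF x, of i] unfolding frame_with_bounds_def G_def by blast+
    have lower: "A0 * ?L i \<le> G i" for i
      using G(2)[of i] mult_right_mono[OF A0(2)[of i], of "?L i"] by simp
    have upper: "G i \<le> B0 * ?L i" for i
      using G(3)[of i] mult_right_mono[OF B0[of i], of "?L i"] by simp
    have L: "?L summable_on UNIV" using gf[OF x] by blast
    have G_nonneg: "0 \<le> G i" for i
      unfolding G_def by (intro infsum_nonneg) simp
    have Gs: "G summable_on UNIV"
      by (rule summable_on_comparison_test[OF summable_on_cmult_right[OF L, of B0]])
        (use upper G_nonneg in auto)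
    have "((\<lambda>j. f (i, j)) has_sum G i) UNIV" for i
      unfolding f G_def using G(1) by (rule has_sum_infsum)
    \<comment> \<open>Tonelli: the terms are nonnegative, so summability of the row sums
      \<open>G\<close> gives summability over all pairs.\<close>
    then have sum: "f summable_on UNIV \<times> UNIV"
      by (rule summable_on_SigmaI[OF _ Gs]) (simp add: f)
    then show "f summable_on UNIV"
      by simp
    have "infsum f UNIV = (\<Sum>\<^sub>\<infinity>i. \<Sum>\<^sub>\<infinity>j. f (i, j))"
      using infsum_Sigma_banach[OF sum] by simp
    also have "\<dots> = infsum G UNIV"
      by (intro infsum_cong) (simp add: f G_def)
    finally have eq: "infsum f UNIV = infsum G UNIV" .
    have "A0 * C * (hnorm H x)\<^sup>2 \<le> A0 * infsum ?L UNIV"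
      using gf[OF x] A0(1) by (simp add: mult.assoc)
    also have "\<dots> = (\<Sum>\<^sub>\<infinity>i. A0 * ?L i)"
      by (simp add: infsum_cmult_right')
    also have "\<dots> \<le> infsum f UNIV"
      unfolding eq by (intro infsum_mono summable_on_cmult_right L Gs lower)
    finally show "A0 * C * (hnorm H x)\<^sup>2 \<le> infsum f UNIV" .
    have "infsum f UNIV \<le> (\<Sum>\<^sub>\<infinity>i. B0 * ?L i)"
      unfolding eq by (intro infsum_mono summable_on_cmult_right L Gs upper)
    also have "\<dots> = B0 * infsum ?L UNIV"
      by (simp add: infsum_cmult_right')
    also have "\<dots> \<le> B0 * D * (hnorm H x)\<^sup>2"
      using gf[OF x] A0(1) \<open>A0 \<le> B0\<close> by (simp add: mult.assoc)
    finally show "infsum f UNIV \<le> B0 * D * (hnorm H x)\<^sup>2" .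
  qed
qed

section \<open>Computability of the adjoint images\<close>

lemma computable_adjoint:
  fixes g :: "nat \<Rightarrow> nat \<Rightarrow> 'b"
  assumes H: "computable_hilbert_space F H e"
    and K: "computable_hilbert_space_seq F K d"
    and \<Lambda>: "computable_g_frame F H e K d \<Lambda>"
    and g: "computable_map (prod_rep nat_rep nat_rep)
           (\<lambda>(i, j). hilbert_rep F (K i) (d i)) (\<lambda>(i, j). g i j)"
    and norm: "computable_map (prod_rep nat_rep nat_rep) (\<lambda>_. real_rep)
           (\<lambda>(i, j). hnorm H (adjoint H (K i) (\<Lambda> i) (g i j)))"
  shows "computable_map (prod_rep nat_rep nat_rep) (\<lambda>_. hilbert_rep F H e)
           (\<lambda>(i, j). adjoint H (K i) (\<Lambda> i) (g i j))"
proof -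
  have hH: "hilbert_space F H" and fund: "fundamental_sequence F H e"
    using H unfolding computable_hilbert_space_def by auto
  have hK: "hilbert_space F (K i)" and dK: "range (d i) \<subseteq> carrier (K i)" for i
    using K unfolding computable_hilbert_space_seq_def computable_hilbert_space_def
      fundamental_sequence_def by auto
  interpret H: hilbert_space F H by (fact hH)
  interpret K: hilbert_space F "K i" for i by (fact hK)
  have e: "range e \<subseteq> carrier H"
    using fund unfolding fundamental_sequence_def by blast
  have op: "bounded_operator F H (K i) (\<Lambda> i)" for i
    using \<Lambda> unfolding computable_g_frame_def g_frame_def by blast
  let ?\<alpha> = "comb_enum F H e" and ?\<beta> = "\<lambda>i. comb_enum F (K i) (d i)"
  let ?z = "\<lambda>i j. adjoint H (K i) (\<Lambda> i) (g i j)"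

  have dist_H: "computable_map (prod_rep nat_rep nat_rep) (\<lambda>_. real_rep)
      (\<lambda>(n, m). hdist H (?\<alpha> n) (?\<alpha> m))"
    using H unfolding computable_hilbert_space_def by blast
  \<comment> \<open>A name of the pair \<open>(n, 0)\<close>, which turns the metric of
    \<open>H\<close> into the norm of \<open>?\<alpha> n\<close>.\<close>
  have rec_N: "recursive (Suc 1) (\<lambda>ys. (\<lambda>m ps. if m = 0 then ps ! 0 else 0) (ys ! 0) (tl ys))"
    by (intro recursive_intros; simp)
  obtain N where N: "recursive (Suc 1) (\<lambda>ys. N (ys ! 0) (tl ys))"
    and "\<And>t ps. length ps = 1 \<Longrightarrow>
      \<bar>real (N t ps) - 2 ^ t * (case (ps ! 0, 0) of (n, m) \<Rightarrow> hdist H (?\<alpha> n) (?\<alpha> m))\<bar> \<le> 2"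
  proof (rule recursive_approx[OF dist_H rec_N, of "\<lambda>ps. (ps ! 0, 0)"])
    show "prod_rep nat_rep nat_rep (\<lambda>m. if m = 0 then ps ! 0 else 0) (ps ! 0, 0)" for ps
      by (simp add: prod_rep_def nat_rep_def)
    show "0 \<le> (case z of (n, m) \<Rightarrow> hdist H (?\<alpha> n) (?\<alpha> m))" for z
      using H.comb_enum_closed[OF e] by (simp split: prod.split)
  qed (rule that)
  from this(2)[of "[n]" for n]
  have N_approx: "\<bar>real (N t [n]) - 2 ^ t * hnorm H (?\<alpha> n)\<bar> \<le> 2" for t n
    using H.comb_enum_closed[OF e] by (simp add: H.comb_enum_0)

  have dist_K: "computable_map (prod_rep nat_rep (prod_rep nat_rep nat_rep)) (\<lambda>_. real_rep)
      (\<lambda>(i, n, m). hdist (K i) (?\<beta> i n) (?\<beta> i m))"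
    using K unfolding computable_hilbert_space_seq_def by blast
  \<comment> \<open>In a name of \<open>(i, n, m)\<close> the nested pairing puts \<open>i\<close>
    at position 0, \<open>n\<close> at position 1 and \<open>m\<close> at position 3.\<close>
  have rec_D: "recursive (Suc 3)
      (\<lambda>ys. (\<lambda>m ps. if m = 0 then ps ! 0 else if m - 1 = 0 then ps ! 1 else ps ! 2) (ys ! 0) (tl ys))"
    by (intro recursive_intros; simp)
  obtain D where D: "recursive (Suc 3) (\<lambda>ys. D (ys ! 0) (tl ys))"
    and "\<And>t ps. length ps = 3 \<Longrightarrow> \<bar>real (D t ps) - 2 ^ t *
      (case (ps ! 0, ps ! 1, ps ! 2) of (i, n, m) \<Rightarrow> hdist (K i) (?\<beta> i n) (?\<beta> i m))\<bar> \<le> 2"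
  proof (rule recursive_approx[OF dist_K rec_D, of "\<lambda>ps. (ps ! 0, ps ! 1, ps ! 2)"])
    show "prod_rep nat_rep (prod_rep nat_rep nat_rep)
        (\<lambda>m. if m = 0 then ps ! 0 else if m - 1 = 0 then ps ! 1 else ps ! 2) (ps ! 0, ps ! 1, ps ! 2)" for ps
      by (simp add: prod_rep_def nat_rep_def)
    show "0 \<le> (case z of (i, n, m) \<Rightarrow> hdist (K i) (?\<beta> i n) (?\<beta> i m))" for z
      using K.comb_enum_closed[OF dK] by (simp split: prod.split)
  qed (rule that)
  from this(2)[of "[i, n, m]" for i n m]
  have D_approx: "\<bar>real (D t [i, n, m]) - 2 ^ t * hdist (K i) (?\<beta> i n) (?\<beta> i m)\<bar> \<le> 2" for t i n m
    by simp

  obtain u where u: "recursive 3 (\<lambda>ys. u (ys ! 0) (tl ys))"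
    and u_rep: "\<And>i n. hilbert_rep F (K i) (d i) (\<lambda>t. u t [i, n]) (\<Lambda> i (?\<alpha> n))"
    using recursive_fun_rep[of "hilbert_rep F H e" "\<lambda>i. hilbert_rep F (K i) (d i)" \<Lambda> ?\<alpha>]
      \<Lambda> H.hilbert_rep_const[OF e] unfolding computable_g_frame_def by blast

  define r where "r m ps = (if m = 0 then ps ! 0 else ps ! 1)" for m :: nat and ps :: "nat list"
  have pair: "recursive (Suc 2) (\<lambda>ys. r (ys ! 0) (tl ys))"
    unfolding r_def by (intro recursive_intros; simp)
  have pair_rep: "prod_rep nat_rep nat_rep (\<lambda>m. r m ps) (ps ! 0, ps ! 1)" for ps
    by (simp add: r_def prod_rep_def nat_rep_def)
  obtain v where v: "recursive (Suc 2) (\<lambda>ys. v (ys ! 0) (tl ys))"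
    and "\<And>ps. length ps = 2 \<Longrightarrow> (case (ps ! 0, ps ! 1) of (i, j) \<Rightarrow> hilbert_rep F (K i) (d i))
      (\<lambda>t. v t ps) (case (ps ! 0, ps ! 1) of (i, j) \<Rightarrow> g i j)"
    by (rule recursive_computable_map[OF g pair, of "\<lambda>ps. (ps ! 0, ps ! 1)"])
      (rule pair_rep, rule that)
  from this(2)[of "[i, j]" for i j]
  have v_rep: "hilbert_rep F (K i) (d i) (\<lambda>t. v t [i, j]) (g i j)" for i j
    by simp
  have gc: "g i j \<in> carrier (K i)" for i j
    using v_rep[of i j] unfolding hilbert_rep_def cauchy_rep_def by blast
  have zc: "?z i j \<in> carrier H" for i j
    using adjoint_ip(1)[OF hH hK op gc] .
  obtain Z where Z: "recursive (Suc 2) (\<lambda>ys. Z (ys ! 0) (tl ys))"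
    and "\<And>t ps. length ps = 2 \<Longrightarrow>
      \<bar>real (Z t ps) - 2 ^ t * (case (ps ! 0, ps ! 1) of (i, j) \<Rightarrow> hnorm H (?z i j))\<bar> \<le> 2"
  proof (rule recursive_approx[OF norm pair, of "\<lambda>ps. (ps ! 0, ps ! 1)"])
    show "prod_rep nat_rep nat_rep (\<lambda>m. r m ps) (ps ! 0, ps ! 1)" for ps
      by (rule pair_rep)
    show "0 \<le> (case z of (i, j) \<Rightarrow> hnorm H (?z i j))" for z
      using zc by (simp split: prod.split)
  qed (rule that)
  from this(2)[of "[i, j]" for i j]
  have Z_approx: "\<bar>real (Z t [i, j]) - 2 ^ t * hnorm H (?z i j)\<bar> \<le> 2" for t i j
    by simp

  \<comment> \<open>The error 4 is 2 for the integer approximation plus 2 for replacing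
    \<open>x\<close> and \<open>y\<close> by the \<open>t\<close>-th entries of their names.\<close>
  have dist_approx: "\<bar>real (D t [i, p t, q t]) - 2 ^ t * hdist (K i) x y\<bar> \<le> 4"
    if "hilbert_rep F (K i) (d i) p x" "hilbert_rep F (K i) (d i) q y" for i p q x y t
  proof -
    have "2 ^ t * \<bar>hdist (K i) (?\<beta> i (p t)) (?\<beta> i (q t)) - hdist (K i) x y\<bar> \<le> 2 ^ t * (2 * (1 / 2) ^ t)"
      using K.hdist_approx[OF dK that] by (intro mult_left_mono) auto
    then have "\<bar>2 ^ t * hdist (K i) (?\<beta> i (p t)) (?\<beta> i (q t)) - 2 ^ t * hdist (K i) x y\<bar> \<le> 2"
      by (simp add: abs_mult power_divide flip: right_diff_distrib)
    with D_approx[of t i "p t" "q t"] show ?thesis by simp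
  qed
  have zero_rep: "hilbert_rep F (K i) (d i) (\<lambda>_. 0) \<zero>\<^bsub>K i\<^esub>" for i
    using K.hilbert_rep_const[OF dK, of i 0] by (simp add: K.comb_enum_0)
  have norm_approx: "\<bar>real (D t [i, p t, 0]) - 2 ^ t * hnorm (K i) x\<bar> \<le> 4"
    if "hilbert_rep F (K i) (d i) p x" for i p x t
    using dist_approx[OF that zero_rep, of t] that by (simp add: hilbert_rep_def cauchy_rep_def)

  \<comment> \<open>A single number \<open>m\<close> codes both the candidate \<open>n\<close> and
    the working precision \<open>s\<close>, so one search runs over all pairs. The target exponent
    is \<open>Suc k\<close>, as \<open>hilbert_repI\<close> demands.\<close>
  define T where "T m i j k =
    (let n = fst (prod_decode m); s = snd (prod_decode m); t = s + Suc k in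
      square_test s (N t [n]) (Z t [i, j]) (D t [i, u t [i, n], v t [i, j]])
        (D t [i, u t [i, n], 0]) (D t [i, v t [i, j], 0]))" for m i j k
  have Lc: "\<Lambda> i (?\<alpha> n) \<in> carrier (K i)" for i n
    using u_rep[of i n] unfolding hilbert_rep_def cauchy_rep_def by blast
  note dist_sq = hdist_adjoint_square[OF hH hK op H.comb_enum_closed[OF e] gc]
  \<comment> \<open>Weakened from 2 to the common error 4 of all arguments of the square
    test.\<close>
  have approx4: "\<bar>real (N t [n]) - 2 ^ t * hnorm H (?\<alpha> n)\<bar> \<le> 4"
    "\<bar>real (Z t [i, j]) - 2 ^ t * hnorm H (?z i j)\<bar> \<le> 4" for t n i j
    using N_approx[of t n] Z_approx[of t i j] by linarith+
  note approx = approx4 dist_approx[OF u_rep v_rep] norm_approx[OF u_rep] norm_approx[OF v_rep]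
  have sound: "hdist H (?\<alpha> (fst (prod_decode m))) (?z i j) < (1 / 2) ^ Suc k" if "T m i j k = 0" for m i j k
  proof -
    have "(hdist H (?\<alpha> (fst (prod_decode m))) (?z i j))\<^sup>2 < ((1 / 2) ^ Suc k)\<^sup>2"
      unfolding dist_sq
      by (rule square_test_sound[OF _ _ _ _ _ approx])
        (use that zc Lc gc H.comb_enum_closed[OF e] in \<open>auto simp: T_def Let_def\<close>)
    then show ?thesis
      by (rule power2_less_imp_less) simp
  qed
  have complete: "\<exists>m. T m i j k = 0" for i j k
  proof -
    obtain n where n: "hdist H (?\<alpha> n) (?z i j) < (1 / 2) ^ Suc k"
      using H.comb_enum_dense[OF fund zc, of "(1 / 2) ^ Suc k"] by auto
    then have "(hdist H (?\<alpha> n) (?z i j))\<^sup>2 < ((1 / 2) ^ Suc k)\<^sup>2"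
      using zc H.comb_enum_closed[OF e] by (intro power_strict_mono) auto
    then have "\<exists>s. square_test s (N (s + Suc k) [n]) (Z (s + Suc k) [i, j])
        (D (s + Suc k) [i, u (s + Suc k) [i, n], v (s + Suc k) [i, j]])
        (D (s + Suc k) [i, u (s + Suc k) [i, n], 0]) (D (s + Suc k) [i, v (s + Suc k) [i, j], 0]) = 0"
      unfolding dist_sq
      by (intro square_test_complete[OF _ _ _ _ _ approx])
        (use zc Lc gc H.comb_enum_closed[OF e] in auto)
    then obtain s where "T (prod_encode (n, s)) i j k = 0"
      by (auto simp: T_def Let_def)
    then show ?thesis by blast
  qed
  have [recursive_intros]:
    "recursive a f \<Longrightarrow> recursive a h \<Longrightarrow> recursive a (\<lambda>xs. N (f xs) [h xs])"
    "recursive a f \<Longrightarrow> recursive a h \<Longrightarrow> recursive a k \<Longrightarrow> recursive a (\<lambda>xs. Z (f xs) [h xs, k xs])"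
    "recursive a f \<Longrightarrow> recursive a h \<Longrightarrow> recursive a k \<Longrightarrow> recursive a (\<lambda>xs. u (f xs) [h xs, k xs])"
    "recursive a f \<Longrightarrow> recursive a h \<Longrightarrow> recursive a k \<Longrightarrow> recursive a (\<lambda>xs. v (f xs) [h xs, k xs])"
    "recursive a f \<Longrightarrow> recursive a h \<Longrightarrow> recursive a k \<Longrightarrow> recursive a l \<Longrightarrow>
      recursive a (\<lambda>xs. D (f xs) [h xs, k xs, l xs])" for a f h k l
    using recursive_app1[of N a f h] recursive_app2[of Z a f h k] recursive_app2[of u a f h k]
      recursive_app2[of v a f h k] recursive_app3[of D a f h k l] N Z u v D
    by (simp_all add: eval_nat_numeral)
  have "recursive 3 (\<lambda>xs. LEAST m. T m (xs ! 0) (xs ! 1) (xs ! 2) = 0)"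
  proof (rule recursive_Least[OF _ complete])
    show "recursive (Suc 3) (\<lambda>ys. T (ys ! 0) (tl ys ! 0) (tl ys ! 1) (tl ys ! 2))"
      unfolding T_def Let_def square_test_def
      by (intro recursive_intros; simp)
  qed
  then have "recursive 3 (\<lambda>xs. fst (prod_decode (LEAST m. T m (xs ! 0) (xs ! 1) (xs ! 2) = 0)))"
    by (intro recursive_intros)
  then show ?thesis
  proof (rule computable_map_recursive)
    fix i j
    have "T (LEAST m. T m i j k = 0) i j k = 0" for k
      by (rule LeastI_ex) (rule complete)
    then have "hilbert_rep F H e (\<lambda>k. fst (prod_decode (LEAST m. T m i j k = 0))) (?z i j)"
      by (intro H.hilbert_repI e zc sound)
    then show "hilbert_rep F H e (\<lambda>k. fst (prod_decode (LEAST m. T m i j k = 0)))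
        ((\<lambda>(i, j). ?z i j) (i, j))"
      by simp
  qed
qed

theorem theorem3p8:
  fixes F :: "complex set"
    and H :: "'a ip_space" and e :: "nat \<Rightarrow> 'a"
    and K :: "nat \<Rightarrow> 'b ip_space" and d :: "nat \<Rightarrow> nat \<Rightarrow> 'b"
    and \<Lambda> :: "nat \<Rightarrow> 'a \<Rightarrow> 'b" and g :: "nat \<Rightarrow> nat \<Rightarrow> 'b"
    and A B :: "nat \<Rightarrow> real"
  assumes "computable_hilbert_space F H e"
    and "computable_hilbert_space_seq F K d"
    and "computable_g_frame F H e K d \<Lambda>"
    and "\<And>i. computable_frame nat_rep F (K i) (d i) (g i)"
    and "computable_map (prod_rep nat_rep nat_rep)
           (\<lambda>(i, j). hilbert_rep F (K i) (d i)) (\<lambda>(i, j). g i j)"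
    and "\<And>i. frame_with_bounds (K i) (g i) (A i) (B i)"
    and "0 < (INF i. ereal (A i))" and "(SUP i. ereal (B i)) < \<infinity>"
    and "computable_map (prod_rep nat_rep nat_rep) (\<lambda>_. real_rep)
           (\<lambda>(i, j). hnorm H (adjoint H (K i) (\<Lambda> i) (g i j)))"
  shows "computable_frame (prod_rep nat_rep nat_rep) F H e
           (\<lambda>(i, j). adjoint H (K i) (\<Lambda> i) (g i j))"
  unfolding computable_frame_def
proof
  \<comment> \<open>Any real strictly between 0 and the infimum is a positive lower bound for all
    \<open>A i\<close>.\<close>
  obtain A0 where A0: "0 < A0" "ereal A0 < (INF i. ereal (A i))"
    using ereal_dense2[OF assms(7)] by auto
  then have "A0 \<le> A i" for i
    using less_INF_D[OF A0(2), of i] by simp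
  moreover obtain B0 where B0: "(SUP i. ereal (B i)) < ereal B0"
    using ereal_dense2[OF assms(8)] by auto
  then have "B i \<le> B0" for i
    using SUP_lessD[OF B0, of i] by simp
  moreover have "hilbert_space F H" "hilbert_space F (K i)" for i
    using assms(1,2) unfolding computable_hilbert_space_seq_def computable_hilbert_space_def by auto
  ultimately show "\<exists>A B. frame_with_bounds H (\<lambda>(i, j). adjoint H (K i) (\<Lambda> i) (g i j)) A B"
    using assms(3,6) A0(1) unfolding computable_g_frame_def
    by (intro frame_adjoint[of F H K \<Lambda> g A B A0 B0]) auto
qed (rule computable_adjoint[OF assms(1-3,5,9)])

end
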